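(* Let $F$, $G$ and $\mathbf{C}$ be the generating functions defined in the context. Then $$F(t,u,v,w,y,z)=\frac{\mathbf{C}(uyz)\,G(t,u,v,w,z)}{1-y u^2 z^2\, \mathbf{C}^2(uyz)\, G(1,u,v,1,z)\, G(1,v,u,1,z)}$$ $$=\frac{2B(2+(v-u)z+A)}{\left[2+(u+v-2tu)wz+wA\right]\left[(A+(v-u)z)B-4uyz\right]},$$ where $A:=\sqrt{1-2(u+v)z+(u-v)^2 z^2}-1$ and $B:=\sqrt{1-4uyz}-1$.
   Context: A Dyck path of length $2n$ is a lattice path from $(0,0)$ to $(2n,0)$ consisting of up-steps $\mathbf{u}=(1,1)$ and down-steps $\mathbf{d}=(1,-1)$ that never goes below the $x$-axis; it is identified with its word in $\mathbf{u},\mathbf{d}$ (bold letters are steps; $t,u,v,w,y,z$ are formal variables). $\mathcal{D}_n$ is the set of Dyck paths of length $2n$, $\mathcal{D}=\bigcup_{n\ge0}\mathcal{D}_n$, and $|D|=n$ for $D\in\mathcal{D}_n$. A tunnel of $D$ is a decomposition $D=A'\mathbf{u}B'\mathbf{d}C'$ with $B'$ a (possibly empty) Dyck path, viewed as the horizontal segment from the beginning of the displayed $\mathbf{u}$ to the end of the displayed $\mathbf{d}$. A multitunnel of $D$ is a decomposition $D=A'B'C'$ with $B'$ a nonempty Dyck path, viewed as the horizontal segment joining the initial and final points of $B'$. Midpoints are those of these segments. For $D\in\mathcal{D}_n$ and $0\le r\le n$, let $a_r(D)$, $b_r(D)$, $c_r(D)$ be the numbers of tunnels of $D$ whose midpoint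 has $x$-coordinate, respectively, $=n+r$, $\le n+r$, $>n+r$, and let $m_r(D)$ be the number of multitunnels of $D$ whose midpoint has $x$-coordinate $n+r$. Define $$F(t,u,v,w,y,z)=\sum_{n\ge0}\ \sum_{r=0}^{n}\ \sum_{D\in\mathcal{D}_n} t^{a_r(D)}u^{b_r(D)}v^{c_r(D)}w^{m_r(D)}y^r z^n.$$ Define $$G(t,u,v,w,z)=\sum_{D\in\mathcal{D}} t^{h(D)} u^{\mathrm{or}(D)} v^{\mathrm{er}(D)} w^{\mathrm{ret}(D)} z^{|D|},$$ where $h(D)$ is the number of hills (peaks $\mathbf{u}\mathbf{d}$ whose top has height $1$), $\mathrm{or}(D)$ (resp. $\mathrm{er}(D)$) is the number of up-steps in odd (resp. even) position when steps are numbered from left to right starting with $1$, and $\mathrm{ret}(D)$ is the number of down-steps landing on the $x$-axis. $\mathbf{C}(z)=\sum_{D\in\mathcal{D}}z^{|D|}=\frac{1-\sqrt{1-4z}}{2z}$ is the Catalan generating function. Identities are between formal power series in $z$; square roots are the power series in $z$ with constant term $1$. *)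

theory Defs
  imports "HOL-Computational_Algebra.Formal_Power_Series"
begin

datatype step = Up | Down

fun step_height :: "step \<Rightarrow> int" where
  "step_height Up = 1"
| "step_height Down = -1"

definition height :: "step list \<Rightarrow> int" where
  "height p = (\<Sum>s\<leftarrow>p. step_height s)"

definition dyck :: "step list \<Rightarrow> bool" where
  "dyck p \<longleftrightarrow> (\<forall>k\<le>length p. 0 \<le> height (take k p)) \<and> height p = 0"

definition dyck_paths :: "nat \<Rightarrow> step list set" where
  "dyck_paths n = {p. dyck p \<and> length p = 2 * n}"

definition semilength :: "step list \<Rightarrow> nat" where
  "semilength p = length p div 2"

lemma finite_dyck_paths: "finite (dyck_paths n)"
proof (rule finite_subset)
  have "s \<in> {Up, Down}" for s
    by (cases s) auto
  then show "dyck_paths n \<subseteq> {p. set p \<subseteq> {Up, Down} \<and> length p = 2 * n}"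
    by (auto simp: dyck_paths_def)
  show "finite {p. set p \<subseteq> {Up, Down} \<and> length p = 2 * n}"
    by (rule finite_lists_length_eq) simp
qed

text \<open>
  A decomposition is recorded as the triple of its three words. As a path has one step per
  unit of the $x$-axis, the $x$-coordinate of a point on it is the length of the prefix
  ending there.
\<close>

definition tunnels :: "step list \<Rightarrow> (step list \<times> step list \<times> step list) set" where
  "tunnels p = {(a, b, c). p = a @ [Up] @ b @ [Down] @ c \<and> dyck b}"

definition multitunnels :: "step list \<Rightarrow> (step list \<times> step list \<times> step list) set" where
  "multitunnels p = {(a, b, c). p = a @ b @ c \<and> dyck b \<and> b \<noteq> []}"

definition tunnel_mid :: "step list \<times> step list \<times> step list \<Rightarrow> rat" where
  "tunnel_mid = (\<lambda>(a, b, c).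
     (of_nat (length a) + of_nat (length (a @ [Up] @ b @ [Down]))) / 2)"

definition multitunnel_mid :: "step list \<times> step list \<times> step list \<Rightarrow> rat" where
  "multitunnel_mid = (\<lambda>(a, b, c). (of_nat (length a) + of_nat (length (a @ b))) / 2)"

lemma finite_multitunnels: "finite (multitunnels p)"
proof (rule finite_subset)
  let ?f = "\<lambda>(i, j). (take i p, take j (drop i p), drop j (drop i p))"
  show "multitunnels p \<subseteq> ?f ` ({..length p} \<times> {..length p})"
  proof
    fix x assume "x \<in> multitunnels p"
    then obtain a b c where "x = (a, b, c)" "p = a @ b @ c"
      by (auto simp: multitunnels_def)
    then show "x \<in> ?f ` ({..length p} \<times> {..length p})"
      by (intro image_eqI[of _ _ "(length a, length b)"]) auto
  qed
qed simp

lemma finite_tunnels: "finite (tunnels p)"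
proof (rule finite_subset)
  let ?f = "\<lambda>(i, j). (take i p, take j (drop (Suc i) p), drop (Suc j) (drop (Suc i) p))"
  show "tunnels p \<subseteq> ?f ` ({..length p} \<times> {..length p})"
  proof
    fix x assume "x \<in> tunnels p"
    then obtain a b c where "x = (a, b, c)" "p = a @ [Up] @ b @ [Down] @ c"
      by (auto simp: tunnels_def)
    then show "x \<in> ?f ` ({..length p} \<times> {..length p})"
      by (intro image_eqI[of _ _ "(length a, length b)"]) auto
  qed
qed simp

definition tunnels_at :: "nat \<Rightarrow> step list \<Rightarrow> nat" where
  "tunnels_at r p = card {x \<in> tunnels p. tunnel_mid x = of_nat (semilength p + r)}"

definition tunnels_upto :: "nat \<Rightarrow> step list \<Rightarrow> nat" where
  "tunnels_upto r p = card {x \<in> tunnels p. tunnel_mid x \<le> of_nat (semilength p + r)}"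

definition tunnels_beyond :: "nat \<Rightarrow> step list \<Rightarrow> nat" where
  "tunnels_beyond r p = card {x \<in> tunnels p. tunnel_mid x > of_nat (semilength p + r)}"

definition multitunnels_at :: "nat \<Rightarrow> step list \<Rightarrow> nat" where
  "multitunnels_at r p =
     card {x \<in> multitunnels p. multitunnel_mid x = of_nat (semilength p + r)}"

text \<open>
  In all generating functions the series variable $z$ is the formal variable of the power
  series type; the remaining variables are elements of an arbitrary coefficient ring, which
  may in particular be indeterminates of a field of rational functions.
\<close>

definition tunnel_gf ::
    "'a::comm_semiring_1 \<Rightarrow> 'a \<Rightarrow> 'a \<Rightarrow> 'a \<Rightarrow> 'a \<Rightarrow> 'a fps" where
  "tunnel_gf t u v w y = Abs_fps (\<lambda>n. \<Sum>r=0..n. \<Sum>p\<in>dyck_paths n.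
     t ^ tunnels_at r p * u ^ tunnels_upto r p * v ^ tunnels_beyond r p *
     w ^ multitunnels_at r p * y ^ r)"

text \<open>
  List indices start at \<open>0\<close>: the step \<open>p ! i\<close> is in position \<open>i + 1\<close> and
  ends at height \<open>height (take (i + 1) p)\<close>.
\<close>

definition hills :: "step list \<Rightarrow> nat" where
  "hills p = card {i. i + 1 < length p \<and> p ! i = Up \<and> p ! (i + 1) = Down \<and>
     height (take (i + 1) p) = 1}"

definition odd_ups :: "step list \<Rightarrow> nat" where
  "odd_ups p = card {i. i < length p \<and> p ! i = Up \<and> odd (i + 1)}"

definition even_ups :: "step list \<Rightarrow> nat" where
  "even_ups p = card {i. i < length p \<and> p ! i = Up \<and> even (i + 1)}"

definition returns :: "step list \<Rightarrow> nat" where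
  "returns p = card {i. i < length p \<and> p ! i = Down \<and> height (take (i + 1) p) = 0}"

definition hill_gf :: "'a::comm_semiring_1 \<Rightarrow> 'a \<Rightarrow> 'a \<Rightarrow> 'a \<Rightarrow> 'a fps" where
  "hill_gf t u v w = Abs_fps (\<lambda>n. \<Sum>p\<in>dyck_paths n.
     t ^ hills p * u ^ odd_ups p * v ^ even_ups p * w ^ returns p)"

definition catalan_gf :: "'a::comm_semiring_1 fps" where
  "catalan_gf = Abs_fps (\<lambda>n. \<Sum>p\<in>dyck_paths n. 1)"

definition fps_sqrt :: "'a::field_char_0 fps \<Rightarrow> 'a fps" where
  "fps_sqrt f = fps_radical (\<lambda>_ _. 1) 2 f"

lemma fps_sqrt_unique:
  assumes "fps_nth f 0 = 1"
  shows "g = fps_sqrt f \<longleftrightarrow> g ^ 2 = f \<and> fps_nth g 0 = 1"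
proof -
  have sq: "fps_sqrt f ^ 2 = f"
    using power_radical[of f "\<lambda>_ _. 1" 1] assms
    by (simp add: fps_sqrt_def numeral_2_eq_2)
  have c: "fps_nth (fps_sqrt f) 0 = 1"
    by (simp add: fps_sqrt_def)
  have "g = fps_sqrt f" if "g ^ 2 = f" "fps_nth g 0 = 1"
  proof -
    have "g = fps_sqrt f \<or> g = - fps_sqrt f"
      using sq that(1) by (metis power2_eq_iff)
    moreover have "g \<noteq> - fps_sqrt f"
    proof
      assume "g = - fps_sqrt f"
      then have "(1::'a) = - 1"
        using c that(2) by simp
      then show False
        by simp
    qed
    ultimately show ?thesis by blast
  qed
  then show ?thesis
    using sq c by blast
qed

end

theory Submission
  imports Defs
begin

text \<open>
  The proof rests on reading a word from both ends alternately: first step, last step, second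
  step, last but one, and so on. Draw an up-step whenever the step just read belongs to a tunnel
  whose other end has not been read, and a down-step otherwise. The height reached is the number
  of tunnels that have been opened and not closed. A tunnel that is opened from the left has its
  midpoint at or before the middle of the word, and this happens at odd times; a tunnel that is
  opened from the right has its midpoint beyond the middle, at an even time. A tunnel centred at
  the middle is opened and closed at consecutive times on the axis, so it gives a hill, and the
  centred multitunnels correspond to the returns to the axis.

  The proof compares recursions. Words with \<open>a\<close> unmatched down-steps and \<open>b\<close> unmatched up-steps are
  summed with the weights of their tunnels about the centre, and removing one step from the left
  or from the right gives recursions for these sums
  (\<open>centred_sum_Cons\<close>, \<open>centred_sum_snoc\<close>, \<open>centred_sum_Cons_dyck\<close>). They are the recursions for
  paths from height \<open>a + b\<close> to the axis, whose generating function is a product of hill series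
  (\<open>path_gf\<close>) by the first-return decomposition \<open>hill_gf_first_return\<close>. So both sides agree by
  induction on the length: \<open>centred_sum_eq_path_gf\<close>.

  If the centre is \<open>n + r\<close> instead of \<open>n\<close>, then the first \<open>2 * r\<close> steps are cut off first. All
  tunnels that start there have their midpoint before the centre, so the prefix is weighted only by
  its number of up-steps (\<open>centred_weight_append\<close>), and what remains is centred. If the prefix
  ends at height \<open>2 * k\<close>, the prefixes contribute \<open>C ^ (2 * k + 1)\<close>, where \<open>C\<close> is the Catalan series at
  \<open>u * y * z\<close>, and the suffixes \<open>path_gf t u v w (2 * k)\<close>, which is
  \<open>hill_gf t u v w * (hill_gf 1 u v 1 * hill_gf 1 v u 1) ^ k\<close>.
  Summation over \<open>k\<close> is a geometric series (\<open>tunnel_gf_eq\<close>). The expression with square roots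
  follows because \<open>C\<close> and the two hill series without \<open>t\<close> and \<open>w\<close> are roots of quadratic equations,
  and \<open>hill_gf t u v w\<close> is a rational function of one of them.
\<close>

unbundle fps_syntax

section \<open>Words modulo cancellation of matched steps\<close>

text \<open>
  Cancelling every matched pair turns a word into \<open>Down^a Up^b\<close>, the normal form of an element of
  the bicyclic monoid. \<open>deficit\<close> is \<open>a\<close> and \<open>surplus\<close> is \<open>b\<close>; the recursion is left multiplication
  by one generator, so that \<open>0 - 1 = 0\<close> is the correct value for an up-step that finds no down-step
  to cancel.
\<close>

primrec deficit :: "step list \<Rightarrow> nat" where
  "deficit [] = 0"
| "deficit (s # p) = (case s of Up \<Rightarrow> deficit p - 1 | Down \<Rightarrow> Suc (deficit p))"

primrec surplus :: "step list \<Rightarrow> nat" where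
  "surplus [] = 0"
| "surplus (s # p) = (if s = Up \<and> deficit p = 0 then Suc (surplus p) else surplus p)"

text \<open>
  This and the next lemma are the multiplication of the bicyclic monoid.
\<close>

lemma deficit_append: "deficit (p @ q) = deficit p + (deficit q - surplus p)"
  by (induction p) (auto split: step.splits)

lemma surplus_append: "surplus (p @ q) = surplus q + (surplus p - deficit q)"
  by (induction p) (auto simp: deficit_append split: step.splits)

lemma height_Nil [simp]: "height [] = 0"
  by (simp add: height_def)

lemma height_Cons [simp]: "height (s # p) = step_height s + height p"
  by (simp add: height_def)

lemma height_append [simp]: "height (p @ q) = height p + height q"
  by (simp add: height_def)

lemma height_eq: "height p = int (surplus p) - int (deficit p)"
  by (induction p) (auto split: step.splits)

text \<open>
  The deficit is the depth of the lowest point of the word below its start. Stating this with a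
  slack \<open>h\<close> makes it inductive: an up-step raises the slack by one and a down-step lowers it.
\<close>

lemma deficit_le_iff: "deficit p \<le> h \<longleftrightarrow> (\<forall>k\<le>length p. 0 \<le> int h + height (take k p))"
proof (induction p arbitrary: h)
  case (Cons s p)
  have split: "(\<forall>k\<le>length (s # p). 0 \<le> int h + height (take k (s # p))) \<longleftrightarrow>
      (\<forall>k\<le>length p. 0 \<le> int h + (step_height s + height (take k p)))"
    (is "?L \<longleftrightarrow> ?R")
  proof
    assume ?L
    show ?R
    proof (intro allI impI)
      fix k assume "k \<le> length p"
      with \<open>?L\<close>[rule_format, of "Suc k"]
      show "0 \<le> int h + (step_height s + height (take k p))" by simp
    qed
  next
    assume ?R
    show ?L
    proof (intro allI impI)
      fix k assume "k \<le> length (s # p)"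
      with \<open>?R\<close>[rule_format, of "k - 1"]
      show "0 \<le> int h + height (take k (s # p))" by (cases k) auto
    qed
  qed
  show ?case
  proof (cases s)
    case Up
    have "deficit (s # p) \<le> h \<longleftrightarrow> deficit p \<le> Suc h"
      using Up by auto
    then show ?thesis
      unfolding split Cons.IH[of "Suc h"] using Up by (simp add: algebra_simps)
  next
    case Down
    show ?thesis
    proof (cases h)
      case 0
      then have "\<not> ?thesis \<longleftrightarrow> False"
        unfolding split using Down by (auto intro!: exI[of _ 0])
      then show ?thesis by blast
    next
      case (Suc h')
      then show ?thesis
        unfolding split using Down Cons.IH[of h'] by (simp add: algebra_simps)
    qed
  qed
qed simp

lemma dyck_iff: "dyck p \<longleftrightarrow> deficit p = 0 \<and> surplus p = 0"
  using deficit_le_iff[of p 0] by (auto simp: dyck_def height_eq)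

lemma dyck_Nil [simp]: "dyck []"
  by (simp add: dyck_iff)

text \<open>
  The partner of an up-step placed in front of \<open>p\<close> is the first unmatched down-step of \<open>p\<close>. Together
  with uniqueness below, prepending an up-step creates exactly one new tunnel if the deficit is
  positive, and none otherwise.
\<close>

lemma first_unmatched_Down:
  assumes "deficit p > 0"
  shows "\<exists>b c. p = b @ Down # c \<and> dyck b"
  using assms
proof (induction "length p" arbitrary: p rule: less_induct)
  case less
  then obtain s q where p: "p = s # q" by (cases p) auto
  show ?case
  proof (cases s)
    case Down
    with p show ?thesis by (intro exI[of _ "[]"] exI[of _ q]) simp
  next
    case Up
    with p less.prems have "deficit q \<ge> 2" by simp
    with less.hyps[of q] p obtain b c where q: "q = b @ Down # c" "dyck b"
      by auto
    with \<open>deficit q \<ge> 2\<close> have "deficit c > 0"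
      by (simp add: deficit_append dyck_iff)
    with less.hyps[of c] p q obtain b' c' where c: "c = b' @ Down # c'" "dyck b'"
      by auto
    show ?thesis
    proof (intro exI conjI)
      show "p = (Up # b @ Down # b') @ Down # c'"
        using p Up q c by simp
      show "dyck (Up # b @ Down # b')"
        using q(2) c(2) by (simp add: dyck_iff deficit_append surplus_append)
    qed
  qed
qed

lemma last_unmatched_Up:
  assumes "surplus p > 0"
  shows "\<exists>a b. p = a @ Up # b \<and> dyck b"
  using assms
proof (induction "length p" arbitrary: p rule: less_induct)
  case less
  then obtain s q where p: "p = q @ [s]" by (cases p rule: rev_cases) auto
  show ?case
  proof (cases s)
    case Up
    with p show ?thesis by (intro exI[of _ q] exI[of _ "[]"]) simp
  next
    case Down
    with p less.prems have "surplus q \<ge> 2" by (simp add: surplus_append)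
    with less.hyps[of q] p obtain a b where q: "q = a @ Up # b" "dyck b"
      by auto
    with \<open>surplus q \<ge> 2\<close> have "surplus a > 0"
      by (simp add: surplus_append dyck_iff)
    with less.hyps[of a] p q obtain a' b' where a: "a = a' @ Up # b'" "dyck b'"
      by auto
    show ?thesis
    proof (intro exI conjI)
      show "p = a' @ Up # (b' @ Up # b @ [Down])"
        using p Down q a by simp
      show "dyck (b' @ Up # b @ [Down])"
        using q(2) a(2) by (simp add: dyck_iff deficit_append surplus_append)
    qed
  qed
qed

text \<open>
  A longer prefix would contain the shorter Dyck path followed by a down-step, which goes below
  the starting level.
\<close>

lemma first_unmatched_Down_unique:
  assumes "b @ Down # c = b' @ Down # c'" "dyck b" "dyck b'"
  shows "b' = b" and "c' = c"
proof -
  from assms(1) have "b' = b \<and> c' = c \<or> (\<exists>x. b' = b @ Down # x) \<or> (\<exists>x. b = b' @ Down # x)"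
    by (auto simp: append_eq_append_conv2 Cons_eq_append_conv append_eq_Cons_conv)
  then show "b' = b" "c' = c"
    using assms(2,3) by (auto simp: dyck_iff deficit_append)
qed

lemma last_unmatched_Up_unique:
  assumes "a @ Up # b = a' @ Up # b'" "dyck b" "dyck b'"
  shows "a' = a" and "b' = b"
proof -
  from assms(1) have "b' = b \<and> a' = a \<or> (\<exists>x. b' = x @ Up # b) \<or> (\<exists>x. b = x @ Up # b')"
    by (auto simp: append_eq_append_conv2 Cons_eq_append_conv append_eq_Cons_conv)
  then show "a' = a" "b' = b"
    using assms(2,3) by (auto simp: dyck_iff surplus_append)
qed

text \<open>
  For a fixed length, the sets \<open>words l a b\<close> partition all words. Dyck paths are \<open>a = b = 0\<close>,
  prefixes of Dyck paths are \<open>a = 0\<close>, and suffixes are \<open>b = 0\<close>.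
\<close>

definition words :: "nat \<Rightarrow> nat \<Rightarrow> nat \<Rightarrow> step list set" where
  "words l a b = {p. length p = l \<and> deficit p = a \<and> surplus p = b}"

lemma finite_words: "finite (words l a b)"
proof (rule finite_subset)
  have "s \<in> {Up, Down}" for s
    by (cases s) auto
  then show "words l a b \<subseteq> {p. set p \<subseteq> {Up, Down} \<and> length p = l}"
    by (auto simp: words_def)
  show "finite {p. set p \<subseteq> {Up, Down} \<and> length p = l}"
    by (rule finite_lists_length_eq) simp
qed

lemma deficit_surplus_le_length: "deficit p + surplus p \<le> length p"
  by (induction p) (auto split: step.splits)

lemma dyck_paths_eq_words: "dyck_paths n = words (2 * n) 0 0"
  by (auto simp: dyck_paths_def words_def dyck_iff)

lemma words_empty: "l < a + b \<Longrightarrow> words l a b = {}"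
  unfolding words_def using deficit_surplus_le_length not_less by blast

section \<open>Tunnels and multitunnels under adding one step\<close>

text \<open>
  The predicate on the midpoint is kept general, because adding a step in front moves all
  midpoints by one while adding a step at the end leaves them in place.
\<close>

definition tunnel_count :: "(rat \<Rightarrow> bool) \<Rightarrow> step list \<Rightarrow> nat" where
  "tunnel_count R p = card {x \<in> tunnels p. R (tunnel_mid x)}"

definition multitunnel_count :: "(rat \<Rightarrow> bool) \<Rightarrow> step list \<Rightarrow> nat" where
  "multitunnel_count R p = card {x \<in> multitunnels p. R (multitunnel_mid x)}"

lemma half_sum_le_iff: "(of_nat i + of_nat j) / 2 \<le> (of_nat c :: rat) \<longleftrightarrow> i + j \<le> 2 * c"
proof -
  have "i + j \<le> 2 * c \<longleftrightarrow> of_nat (i + j) \<le> (of_nat (2 * c) :: rat)"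
    by (simp only: of_nat_le_iff)
  then show ?thesis by (simp add: mult.commute)
qed

lemma half_sum_eq_iff: "(of_nat i + of_nat j) / 2 = (of_nat c :: rat) \<longleftrightarrow> i + j = 2 * c"
proof -
  have "i + j = 2 * c \<longleftrightarrow> of_nat (i + j) = (of_nat (2 * c) :: rat)"
    by (simp only: of_nat_eq_iff)
  then show ?thesis by (simp add: field_simps)
qed

definition cons_prefix where
  "cons_prefix s = (\<lambda>(a :: step list, b :: step list, c :: step list). (s # a, b, c))"

definition snoc_suffix where
  "snoc_suffix s = (\<lambda>(a :: step list, b :: step list, c :: step list). (a, b, c @ [s]))"

lemma inj_cons_prefix: "inj (cons_prefix s)"
  by (auto simp: inj_on_def cons_prefix_def)

lemma inj_snoc_suffix: "inj (snoc_suffix s)"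
  by (auto simp: inj_on_def snoc_suffix_def)

lemma Nil_neq_cons_prefix [simp]: "([], b, c) \<noteq> cons_prefix s x" "cons_prefix s x \<noteq> ([], b, c)"
  by (cases x; simp add: cons_prefix_def)+

lemma Nil_neq_snoc_suffix [simp]: "(a, b, []) \<noteq> snoc_suffix s x" "snoc_suffix s x \<noteq> (a, b, [])"
  by (cases x; simp add: snoc_suffix_def)+

lemma tunnel_mid_cons_prefix: "tunnel_mid (cons_prefix s x) = tunnel_mid x + 1"
  by (cases x) (simp add: tunnel_mid_def cons_prefix_def field_simps)

lemma multitunnel_mid_cons_prefix: "multitunnel_mid (cons_prefix s x) = multitunnel_mid x + 1"
  by (cases x) (simp add: multitunnel_mid_def cons_prefix_def field_simps)

lemma tunnel_mid_snoc_suffix: "tunnel_mid (snoc_suffix s x) = tunnel_mid x"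
  by (cases x) (simp add: tunnel_mid_def snoc_suffix_def)

lemma multitunnel_mid_snoc_suffix: "multitunnel_mid (snoc_suffix s x) = multitunnel_mid x"
  by (cases x) (simp add: multitunnel_mid_def snoc_suffix_def)

lemma tunnels_Cons:
  "tunnels (s # p) = cons_prefix s ` tunnels p \<union>
     {([], b, c) | b c. s = Up \<and> p = b @ Down # c \<and> dyck b}"
  by (auto simp: tunnels_def cons_prefix_def image_iff Cons_eq_append_conv)

lemma tunnels_snoc:
  "tunnels (p @ [s]) = snoc_suffix s ` tunnels p \<union>
     {(a, b, []) | a b. s = Down \<and> p = a @ Up # b \<and> dyck b}"
proof -
  have "(a, b, c) \<in> tunnels (p @ [s]) \<longleftrightarrow> (a, b, c) \<in> snoc_suffix s ` tunnels p \<union>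
     {(a, b, []) | a b. s = Down \<and> p = a @ Up # b \<and> dyck b}" for a b c
    by (cases c rule: rev_cases) (auto simp: tunnels_def snoc_suffix_def image_iff
        simp flip: append_assoc append_Cons)
  then show ?thesis by auto
qed

lemma multitunnels_Cons:
  "multitunnels (s # p) = cons_prefix s ` multitunnels p \<union>
     {([], b, c) | b c. s # p = b @ c \<and> dyck b \<and> b \<noteq> []}"
  by (auto simp: multitunnels_def cons_prefix_def image_iff Cons_eq_append_conv)

lemma multitunnels_snoc:
  "multitunnels (p @ [s]) = snoc_suffix s ` multitunnels p \<union>
     {(a, b, []) | a b. p @ [s] = a @ b \<and> dyck b \<and> b \<noteq> []}"
proof -
  have "(a, b, c) \<in> multitunnels (p @ [s]) \<longleftrightarrow> (a, b, c) \<in> snoc_suffix s ` multitunnels p \<union>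
     {(a, b, []) | a b. p @ [s] = a @ b \<and> dyck b \<and> b \<noteq> []}" for a b c
    by (cases c rule: rev_cases) (auto simp: multitunnels_def snoc_suffix_def image_iff
        simp flip: append_assoc)
  then show ?thesis by auto
qed

lemma card_image_Un_filter:
  assumes T: "T = f ` S \<union> N" and "inj f" and "finite T" and "f ` S \<inter> N = {}"
  shows "card {x \<in> T. R x} = card {x \<in> S. R (f x)} + card {x \<in> N. R x}"
proof -
  have eq: "{x \<in> T. R x} = f ` {x \<in> S. R (f x)} \<union> {x \<in> N. R x}"
    using T by auto
  have "finite (f ` {x \<in> S. R (f x)})" "finite {x \<in> N. R x}"
    using assms(3) T by (auto intro: finite_subset)
  moreover have "f ` {x \<in> S. R (f x)} \<inter> {x \<in> N. R x} = {}"
    using assms(4) by auto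
  moreover have "card (f ` {x \<in> S. R (f x)}) = card {x \<in> S. R (f x)}"
    using assms(2) by (simp add: card_image inj_on_def)
  ultimately show ?thesis
    unfolding eq by (simp add: card_Un_disjoint)
qed

lemma tunnel_count_Cons:
  "tunnel_count R (s # p) = tunnel_count (\<lambda>x. R (x + 1)) p +
     card {x \<in> {([], b, c) | b c. s = Up \<and> p = b @ Down # c \<and> dyck b}. R (tunnel_mid x)}"
  unfolding tunnel_count_def
  by (subst card_image_Un_filter[OF tunnels_Cons inj_cons_prefix finite_tunnels])
    (auto simp: tunnel_mid_cons_prefix)

lemma tunnel_count_Cons_unmatched:
  assumes "s = Down \<or> deficit p = 0"
  shows "tunnel_count R (s # p) = tunnel_count (\<lambda>x. R (x + 1)) p"
proof -
  have none: "{([], b, c) | b c. s = Up \<and> p = b @ Down # c \<and> dyck b} =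
      ({} :: (step list \<times> step list \<times> step list) set)"
    using assms by (auto simp: deficit_append dyck_iff)
  show ?thesis
    unfolding tunnel_count_Cons none by simp
qed

lemma tunnel_count_Cons_matched:
  assumes "dyck b"
  shows "tunnel_count R (Up # b @ Down # c) = tunnel_count (\<lambda>x. R (x + 1)) (b @ Down # c) +
    of_bool (R ((of_nat 0 + of_nat (length b + 2)) / 2))"
proof -
  have one: "{([], b', c') | b' c'. Up = Up \<and> b @ Down # c = b' @ Down # c' \<and> dyck b'}
      = {([] :: step list, b, c)}"
    using assms first_unmatched_Down_unique[OF _ assms] by blast
  have "{x \<in> {([] :: step list, b, c)}. R (tunnel_mid x)} =
      (if R ((of_nat 0 + of_nat (length b + 2)) / 2) then {([], b, c)} else {})"
    by (auto simp: tunnel_mid_def)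
  then show ?thesis
    unfolding tunnel_count_Cons one by simp
qed

lemma tunnel_count_snoc:
  "tunnel_count R (p @ [s]) = tunnel_count R p +
     card {x \<in> {(a, b, []) | a b. s = Down \<and> p = a @ Up # b \<and> dyck b}. R (tunnel_mid x)}"
  unfolding tunnel_count_def
  by (subst card_image_Un_filter[OF tunnels_snoc inj_snoc_suffix finite_tunnels])
    (auto simp: tunnel_mid_snoc_suffix)

lemma tunnel_count_snoc_unmatched:
  assumes "s = Up \<or> surplus p = 0"
  shows "tunnel_count R (p @ [s]) = tunnel_count R p"
proof -
  have none: "{(a, b, []) | a b. s = Down \<and> p = a @ Up # b \<and> dyck b} =
      ({} :: (step list \<times> step list \<times> step list) set)"
    using assms by (auto simp: surplus_append dyck_iff split: if_splits)
  show ?thesis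
    unfolding tunnel_count_snoc none by simp
qed

lemma tunnel_count_snoc_matched:
  assumes "dyck b"
  shows "tunnel_count R ((a @ Up # b) @ [Down]) = tunnel_count R (a @ Up # b) +
    of_bool (R ((of_nat (length a) + of_nat (length a + length b + 2)) / 2))"
proof -
  have one: "{(a', b', []) | a' b'. Down = Down \<and> a @ Up # b = a' @ Up # b' \<and> dyck b'}
      = {(a, b, [] :: step list)}"
    using assms last_unmatched_Up_unique[OF _ assms] by blast
  have "{x \<in> {(a, b, [] :: step list)}. R (tunnel_mid x)} =
      (if R ((of_nat (length a) + of_nat (length a + length b + 2)) / 2) then {(a, b, [])} else {})"
    by (auto simp: tunnel_mid_def)
  then show ?thesis
    unfolding tunnel_count_snoc one by simp
qed

text \<open>
  The midpoint of the new multitunnels, which start at the first step, is at most half the length.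
  So with a centre \<open>c\<close> at or beyond the middle, only the whole word can be a new centred one.
\<close>

lemma multitunnel_count_Cons:
  assumes "Suc (length p) \<le> 2 * c"
  shows "multitunnel_count (\<lambda>x. x = of_nat c) (s # p) =
    multitunnel_count (\<lambda>x. x + 1 = of_nat c) p +
    of_bool (Suc (length p) = 2 * c \<and> dyck (s # p))"
proof -
  let ?N = "{([] :: step list, b, c) | b c. s # p = b @ c \<and> dyck b \<and> b \<noteq> []}"
  have "{x \<in> ?N. multitunnel_mid x = of_nat c} =
      (if Suc (length p) = 2 * c \<and> dyck (s # p) then {([], s # p, [])} else {})"
  proof -
    have whole: "d = []" if "s # p = b @ d" "length b = 2 * c" for b d
    proof -
      from that have "Suc (length p) = 2 * c + length d"
        by (metis length_Cons length_append)
      with assms show ?thesis by simp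
    qed
    have "multitunnel_mid ([], b, d) = of_nat c \<longleftrightarrow> length b = 2 * c" for b d
      using half_sum_eq_iff[of 0 "length b" c] by (simp add: multitunnel_mid_def)
    then show ?thesis
      using whole by (auto simp flip: length_Cons)
  qed
  then show ?thesis
    unfolding multitunnel_count_def
    by (subst card_image_Un_filter[OF multitunnels_Cons inj_cons_prefix finite_multitunnels])
      (auto simp: multitunnel_mid_cons_prefix)
qed

text \<open>
  The new multitunnels end at the last step, so that a centre strictly left of the middle is not
  the midpoint of any of them.
\<close>

lemma multitunnel_count_snoc:
  assumes "2 * c \<le> length p"
  shows "multitunnel_count (\<lambda>x. x = of_nat c) (p @ [s]) =
    multitunnel_count (\<lambda>x. x = of_nat c) p"
proof -
  let ?N = "{(a, b, [] :: step list) | a b. p @ [s] = a @ b \<and> dyck b \<and> b \<noteq> []}"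
  have "multitunnel_mid (a, b, []) \<noteq> of_nat c" if "p @ [s] = a @ b" for a b
  proof -
    from that have "Suc (length p) = length a + length b"
      by (metis length_append length_append_singleton)
    with assms show ?thesis
      using half_sum_eq_iff[of "length a" "length a + length b" c]
      by (simp add: multitunnel_mid_def)
  qed
  then have none: "{x \<in> ?N. multitunnel_mid x = of_nat c} = {}"
    by auto
  have "card {x \<in> multitunnels (p @ [s]). multitunnel_mid x = of_nat c} =
      card {x \<in> multitunnels p. multitunnel_mid (snoc_suffix s x) = of_nat c} +
      card {x \<in> ?N. multitunnel_mid x = of_nat c}"
    by (rule card_image_Un_filter[OF multitunnels_snoc inj_snoc_suffix finite_multitunnels]) auto
  then show ?thesis
    unfolding none by (simp add: multitunnel_mid_snoc_suffix multitunnel_count_def)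
qed

section \<open>Reading a word from both ends\<close>

definition centred_weight ::
    "'a::comm_ring_1 \<Rightarrow> 'a \<Rightarrow> 'a \<Rightarrow> 'a \<Rightarrow> nat \<Rightarrow> step list \<Rightarrow> 'a" where
  "centred_weight t u v w c p =
     t ^ tunnel_count (\<lambda>x. x = of_nat c) p * u ^ tunnel_count (\<lambda>x. x \<le> of_nat c) p *
     v ^ tunnel_count (\<lambda>x. x > of_nat c) p * w ^ multitunnel_count (\<lambda>x. x = of_nat c) p"

lemma centred_weight_Nil [simp]: "centred_weight t u v w c [] = 1"
proof -
  have "tunnels [] = {}" "multitunnels [] = {}"
    by (auto simp: tunnels_def multitunnels_def)
  then show ?thesis
    by (simp add: centred_weight_def tunnel_count_def multitunnel_count_def)
qed

lemma mid_shift_le: "x + 1 \<le> of_nat (Suc c) \<longleftrightarrow> x \<le> (of_nat c :: rat)"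
  and mid_shift_gt: "x + 1 > of_nat (Suc c) \<longleftrightarrow> x > (of_nat c :: rat)"
  and mid_shift_eq: "x + 1 = of_nat (Suc c) \<longleftrightarrow> x = (of_nat c :: rat)"
  by auto

lemma centred_weight_Cons_unmatched:
  assumes "s = Down \<or> deficit p = 0"
    and "Suc (length p) \<le> 2 * Suc c" and "\<not> dyck (s # p)"
  shows "centred_weight t u v w (Suc c) (s # p) = centred_weight t u v w c p"
  unfolding centred_weight_def tunnel_count_Cons_unmatched[OF assms(1)]
    multitunnel_count_Cons[OF assms(2)] mid_shift_le mid_shift_gt mid_shift_eq
  using assms(3) by simp

lemma centred_weight_Cons_matched:
  assumes "dyck b" and "length b + length d \<le> 2 * c"
  shows "centred_weight t u v w (Suc c) (Up # b @ Down # d) =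
    u * (if length b = 2 * c then t else 1) *
    (if length b + length d = 2 * c \<and> dyck d then w else 1) *
    centred_weight t u v w c (b @ Down # d)"
proof -
  have len: "Suc (length (b @ Down # d)) \<le> 2 * Suc c"
    using assms(2) by simp
  have le: "(of_nat 0 + of_nat (length b + 2)) / 2 \<le> (of_nat (Suc c) :: rat)"
    unfolding half_sum_le_iff using assms(2) by simp
  then have gt: "\<not> (of_nat 0 + of_nat (length b + 2)) / 2 > (of_nat (Suc c) :: rat)"
    by simp
  have dyck: "dyck (Up # b @ Down # d) \<longleftrightarrow> dyck d"
    using assms(1) by (simp add: dyck_iff deficit_append surplus_append)
  show ?thesis
    unfolding centred_weight_def tunnel_count_Cons_matched[OF assms(1)]
      multitunnel_count_Cons[OF len] mid_shift_le mid_shift_gt mid_shift_eq half_sum_eq_iff dyck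
    using le gt by simp
qed

text \<open>
  If the centre is not to the left of the middle, a tunnel opened by the first step has its midpoint
  at or before the centre, which accounts for the factor \<open>u\<close>. The midpoint equals the centre only
  if the tunnel is the whole word.
\<close>

lemma centred_weight_Cons:
  assumes "Suc (length p) \<le> 2 * Suc c"
    and "Suc (length p) < 2 * Suc c \<or> \<not> dyck (s # p)"
  shows "centred_weight t u v w (Suc c) (s # p) =
    (if s = Up \<and> deficit p > 0 then u else 1) * centred_weight t u v w c p"
proof (cases "s = Up \<and> deficit p > 0")
  case True
  then obtain b d where p: "p = b @ Down # d" "dyck b"
    using first_unmatched_Down by blast
  have "length b + length d \<le> 2 * c"
    using assms(1) p by simp
  moreover have "length b \<noteq> 2 * c" and "\<not> (length b + length d = 2 * c \<and> dyck d)"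
    using assms p True by (auto simp: dyck_iff deficit_append surplus_append)
  ultimately show ?thesis
    using True p by (auto simp: centred_weight_Cons_matched)
next
  case False
  then have s: "s = Down \<or> deficit p = 0"
    by (cases s) auto
  show ?thesis
  proof (cases "dyck (s # p)")
    case True
    with s have False
      by (auto simp: dyck_iff split: step.splits if_splits)
    then show ?thesis ..
  next
    case nd: False
    show ?thesis
      using centred_weight_Cons_unmatched[OF s assms(1) nd] False by auto
  qed
qed

text \<open>
  When a nonempty Dyck word is centred, the word itself is a centred multitunnel, and it is a centred
  tunnel precisely if it consists of a Dyck path between one matched pair of steps.
\<close>

lemma centred_weight_Cons_dyck:
  assumes "Suc (length p) = 2 * Suc c" and "dyck (Up # p)"
  shows "centred_weight t u v w (Suc c) (Up # p) =
    u * w * (if \<exists>b. p = b @ [Down] \<and> dyck b then t else 1) * centred_weight t u v w c p"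
proof -
  from assms(2) have "deficit p = 1" "surplus p = 0"
    by (auto simp: dyck_iff split: if_splits)
  then obtain b d where p: "p = b @ Down # d" "dyck b"
    using first_unmatched_Down[of p] by auto
  have d: "dyck d"
    using \<open>deficit p = 1\<close> \<open>surplus p = 0\<close> p by (auto simp: dyck_iff deficit_append surplus_append)
  have len: "length b + length d = 2 * c"
    using assms(1) p by simp
  have "(\<exists>b'. p = b' @ [Down] \<and> dyck b') \<longleftrightarrow> length b = 2 * c"
  proof
    assume "\<exists>b'. p = b' @ [Down] \<and> dyck b'"
    then have "d = []"
      using p first_unmatched_Down_unique(2)[of b d _ "[]"] by auto
    then show "length b = 2 * c" using len by simp
  next
    assume "length b = 2 * c"
    then show "\<exists>b'. p = b' @ [Down] \<and> dyck b'" using len p by auto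
  qed
  then show ?thesis
    using centred_weight_Cons_matched[OF p(2), of d c t u v w] len d p(1) by auto
qed

text \<open>
  Once the first step of a word of even length has been removed, the centre lies half a unit to the
  left of the middle of the remainder, so that a tunnel closed by the last step is to the right
  of the centre.
\<close>

lemma centred_weight_snoc:
  assumes "length p = 2 * c"
  shows "centred_weight t u v w c (p @ [s]) =
    (if s = Down \<and> surplus p > 0 then v else 1) * centred_weight t u v w c p"
proof (cases "s = Down \<and> surplus p > 0")
  case True
  then obtain a b where p: "p = a @ Up # b" "dyck b"
    using last_unmatched_Up by blast
  have nle: "\<not> (of_nat (length a) + of_nat (length a + length b + 2)) / 2 \<le> (of_nat c :: rat)"
    unfolding half_sum_le_iff using assms p by simp
  then have gt: "(of_nat (length a) + of_nat (length a + length b + 2)) / 2 > (of_nat c :: rat)"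
    and neq: "(of_nat (length a) + of_nat (length a + length b + 2)) / 2 \<noteq> (of_nat c :: rat)"
    by auto
  have "centred_weight t u v w c ((a @ Up # b) @ [Down]) =
    v * centred_weight t u v w c (a @ Up # b)"
    unfolding centred_weight_def tunnel_count_snoc_matched[OF p(2)]
    using nle gt neq assms p(1) by (simp add: multitunnel_count_snoc del: append_assoc)
  then show ?thesis using True p(1) by simp
next
  case False
  then have "s = Up \<or> surplus p = 0"
    by (cases s) auto
  then show ?thesis
    using False assms
    by (auto simp: centred_weight_def tunnel_count_snoc_unmatched multitunnel_count_snoc)
qed

text \<open>
  While the centre is strictly right of the middle, every step can be read from the left. All up-steps
  of \<open>p\<close> are matched in \<open>p @ q\<close>, and each opens a tunnel to the left of the centre; \<open>surplus (p @ q) = 0\<close>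
  is what guarantees that they are matched.
\<close>

lemma centred_weight_append:
  assumes "length q \<le> 2 * c"
  shows "surplus (p @ q) = 0 \<Longrightarrow> centred_weight t u v w (length p + c) (p @ q) =
    u ^ count_list p Up * centred_weight t u v w c q"
proof (induction p)
  case (Cons s p)
  then have "surplus (p @ q) = 0" and "s = Up \<Longrightarrow> deficit (p @ q) > 0"
    by (auto split: if_splits)
  then show ?case
    using Cons assms centred_weight_Cons[of "p @ q" "length p + c" s t u v w]
    by (cases s) (auto simp: mult.assoc)
qed simp

text \<open>
  For even \<open>l\<close> the centre \<open>l div 2\<close> is the middle of the word. For odd \<open>l\<close> it is the old middle
  after the first step of a word of length \<open>l + 1\<close> has been removed. Hence the parity of \<open>l\<close> decides
  from which end the next step is read.
\<close>

definition centred_sum ::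
    "'a::comm_ring_1 \<Rightarrow> 'a \<Rightarrow> 'a \<Rightarrow> 'a \<Rightarrow> nat \<Rightarrow> nat \<Rightarrow> nat \<Rightarrow> 'a" where
  "centred_sum t u v w l a b = (\<Sum>p\<in>words l a b. centred_weight t u v w (l div 2) p)"

lemma words_0: "words 0 a b = (if a = 0 \<and> b = 0 then {[]} else {})"
  by (auto simp: words_def)

text \<open>
  Read from the left, an unmatched step is a down-step as long as the deficit is positive. If the
  deficit is zero, the only possible unmatched first step is an up-step, and it lowers the surplus.
  In each case, removing a matched step raises the number \<open>a + b\<close> of unmatched steps by one, and
  removing an unmatched step lowers it by one.
\<close>

lemma words_Suc_Cons:
  assumes "a + b > 0"
  shows "words (Suc l) a b = Cons Up ` words l (Suc a) b \<union>
    (if a > 0 then Cons Down ` words l (a - 1) b else Cons Up ` words l 0 (b - 1))"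
    (is "?L = ?R")
proof (rule set_eqI)
  fix p
  show "p \<in> ?L \<longleftrightarrow> p \<in> ?R"
    using assms by (cases p) (auto simp: words_def image_iff split: step.splits if_splits)
qed

lemma words_Suc_Cons_dyck: "words (Suc l) 0 0 = Cons Up ` words l 1 0"
proof (rule set_eqI)
  fix p
  show "p \<in> words (Suc l) 0 0 \<longleftrightarrow> p \<in> Cons Up ` words l 1 0"
    by (cases p) (auto simp: words_def image_iff split: step.splits if_splits)
qed

lemma words_Suc_snoc:
  assumes "a + b > 0"
  shows "words (Suc l) a b = (\<lambda>p. p @ [Down]) ` words l a (Suc b) \<union>
    (if b > 0 then (\<lambda>p. p @ [Up]) ` words l a (b - 1)
     else (\<lambda>p. p @ [Down]) ` words l (a - 1) 0)"
    (is "?L = ?R")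
proof (rule set_eqI)
  fix p
  show "p \<in> ?L \<longleftrightarrow> p \<in> ?R"
  proof (cases p rule: rev_cases)
    case (snoc q s)
    then show ?thesis
      using assms by (cases s)
        (auto simp: words_def image_iff deficit_append surplus_append split: if_splits)
  qed (auto simp: words_def)
qed

text \<open>
  In terms of \<open>a + b\<close>, this is the recursion for lattice paths that start at the positive
  height \<open>a + b\<close>: the first step is an up-step with weight \<open>u\<close> or a down-step with weight \<open>1\<close>.
\<close>

lemma centred_sum_Cons:
  assumes "a + b > 0" and "odd l"
  shows "centred_sum t u v w (Suc l) a b = u * centred_sum t u v w l (Suc a) b +
    (if a > 0 then centred_sum t u v w l (a - 1) b else centred_sum t u v w l 0 (b - 1))"
proof -
  obtain c where l: "l = 2 * c + 1" "l div 2 = c" "Suc l div 2 = Suc c"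
    using assms(2) by (auto elim: oddE)
  have up: "(\<Sum>p\<in>Cons Up ` words l a' b'. centred_weight t u v w (Suc c) p) =
      (if a' > 0 then u else 1) * centred_sum t u v w l a' b'"
    if "a' \<noteq> 1 \<or> b' \<noteq> 0" for a' b'
    unfolding centred_sum_def sum_distrib_left l(2)
  proof (subst sum.reindex, simp, rule sum.cong[OF refl], unfold o_def)
    fix p assume "p \<in> words l a' b'"
    then show "centred_weight t u v w (Suc c) (Up # p) =
        (if a' > 0 then u else 1) * centred_weight t u v w c p"
      using that l by (subst centred_weight_Cons) (auto simp: words_def dyck_iff)
  qed
  have down: "(\<Sum>p\<in>Cons Down ` words l a' b. centred_weight t u v w (Suc c) p) =
      centred_sum t u v w l a' b" for a'
    unfolding centred_sum_def l(2)
  proof (subst sum.reindex, simp, rule sum.cong[OF refl], unfold o_def)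
    fix p assume "p \<in> words l a' b"
    then show "centred_weight t u v w (Suc c) (Down # p) = centred_weight t u v w c p"
      using l by (subst centred_weight_Cons) (auto simp: words_def dyck_iff)
  qed
  show ?thesis
  proof (cases "a > 0")
    case True
    then have "centred_sum t u v w (Suc l) a b =
        (\<Sum>p\<in>Cons Up ` words l (Suc a) b. centred_weight t u v w (Suc c) p) +
        (\<Sum>p\<in>Cons Down ` words l (a - 1) b. centred_weight t u v w (Suc c) p)"
      unfolding centred_sum_def words_Suc_Cons[OF assms(1)] l(3)
      by (auto simp: finite_words intro!: sum.union_disjoint)
    then show ?thesis
      using True by (simp add: up down)
  next
    case False
    have disjoint: "Cons Up ` words l (Suc a) b \<inter> Cons Up ` words l 0 (b - 1) = {}"
      using False by (auto simp: words_def)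
    from False have "centred_sum t u v w (Suc l) a b =
        (\<Sum>p\<in>Cons Up ` words l (Suc a) b. centred_weight t u v w (Suc c) p) +
        (\<Sum>p\<in>Cons Up ` words l 0 (b - 1). centred_weight t u v w (Suc c) p)"
      unfolding centred_sum_def words_Suc_Cons[OF assms(1)] l(3)
      using disjoint by (auto simp: finite_words intro!: sum.union_disjoint)
    then show ?thesis
      using False assms(1) by (simp add: up)
  qed
qed

text \<open>
  The mirror image of the previous recursion, in which an up-step has weight \<open>v\<close>.
\<close>

lemma centred_sum_snoc:
  assumes "a + b > 0" and "even l"
  shows "centred_sum t u v w (Suc l) a b = v * centred_sum t u v w l a (Suc b) +
    (if b > 0 then centred_sum t u v w l a (b - 1) else centred_sum t u v w l (a - 1) 0)"
proof -
  obtain c where l: "l = 2 * c" "l div 2 = c" "Suc l div 2 = c"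
    using assms(2) by (auto elim: evenE)
  have inj: "inj_on (\<lambda>p. p @ [s]) X" for s :: step and X
    by (auto simp: inj_on_def)
  have down: "(\<Sum>p\<in>(\<lambda>p. p @ [Down]) ` words l a' b'. centred_weight t u v w c p) =
      (if b' > 0 then v else 1) * centred_sum t u v w l a' b'" for a' b'
    unfolding centred_sum_def sum_distrib_left l(2)
  proof (subst sum.reindex[OF inj], rule sum.cong[OF refl], unfold o_def)
    fix p assume "p \<in> words l a' b'"
    then show "centred_weight t u v w c (p @ [Down]) =
        (if b' > 0 then v else 1) * centred_weight t u v w c p"
      using l by (subst centred_weight_snoc) (auto simp: words_def)
  qed
  have up: "(\<Sum>p\<in>(\<lambda>p. p @ [Up]) ` words l a b'. centred_weight t u v w c p) =
      centred_sum t u v w l a b'" for b'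
    unfolding centred_sum_def l(2)
  proof (subst sum.reindex[OF inj], rule sum.cong[OF refl], unfold o_def)
    fix p assume "p \<in> words l a b'"
    then show "centred_weight t u v w c (p @ [Up]) = centred_weight t u v w c p"
      using l by (subst centred_weight_snoc) (auto simp: words_def)
  qed
  show ?thesis
  proof (cases "b > 0")
    case True
    then have "centred_sum t u v w (Suc l) a b =
        (\<Sum>p\<in>(\<lambda>p. p @ [Down]) ` words l a (Suc b). centred_weight t u v w c p) +
        (\<Sum>p\<in>(\<lambda>p. p @ [Up]) ` words l a (b - 1). centred_weight t u v w c p)"
      unfolding centred_sum_def words_Suc_snoc[OF assms(1)] l(3)
      by (auto simp: finite_words intro!: sum.union_disjoint)
    then show ?thesis
      using True by (simp add: up down)
  next
    case False
    have disjoint: "(\<lambda>p. p @ [Down]) ` words l a (Suc b) \<inter> (\<lambda>p. p @ [Down]) ` words l (a - 1) 0 = {}"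
      using False by (auto simp: words_def)
    from False have "centred_sum t u v w (Suc l) a b =
        (\<Sum>p\<in>(\<lambda>p. p @ [Down]) ` words l a (Suc b). centred_weight t u v w c p) +
        (\<Sum>p\<in>(\<lambda>p. p @ [Down]) ` words l (a - 1) 0. centred_weight t u v w c p)"
      unfolding centred_sum_def words_Suc_snoc[OF assms(1)] l(3)
      using disjoint by (auto simp: finite_words intro!: sum.union_disjoint)
    then show ?thesis
      using False assms(1) by (simp add: down)
  qed
qed

text \<open>
  The recursion on the axis. The weight \<open>w\<close> is paid once for every nonempty Dyck word that becomes
  centred; the term with \<open>t - 1\<close> corrects those in which the tunnel just opened is closed by the
  following step from the right, which corresponds to a hill.
\<close>

lemma centred_sum_Cons_dyck:
  "centred_sum t u v w (Suc (Suc (2 * c))) 0 0 =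
     u * w * (centred_sum t u v w (Suc (2 * c)) 1 0 + (t - 1) * centred_sum t u v w (2 * c) 0 0)"
proof -
  let ?W = "words (Suc (2 * c)) 1 0"
  let ?hat = "(\<lambda>p. p @ [Down]) ` words (2 * c) 0 0"
  \<comment> \<open>The correction concerns words whose last step is the partner of the removed up-step.\<close>
  have hat: "(\<exists>b. p = b @ [Down] \<and> dyck b) \<longleftrightarrow> p \<in> ?hat" if "p \<in> ?W" for p
    using that by (auto simp: words_def dyck_iff)
  have sub: "?hat \<subseteq> ?W"
    by (auto simp: words_def deficit_append surplus_append)
  have "centred_sum t u v w (Suc (Suc (2 * c))) 0 0 =
      (\<Sum>p\<in>?W. centred_weight t u v w (Suc c) (Up # p))"
    unfolding centred_sum_def words_Suc_Cons_dyck by (subst sum.reindex) auto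
  also have "\<dots> = (\<Sum>p\<in>?W. u * w * (centred_weight t u v w c p +
      (t - 1) * (if p \<in> ?hat then centred_weight t u v w c p else 0)))"
  proof (rule sum.cong[OF refl])
    fix p assume p: "p \<in> ?W"
    then have "centred_weight t u v w (Suc c) (Up # p) =
        u * w * (if p \<in> ?hat then t else 1) * centred_weight t u v w c p"
      unfolding hat[OF p, symmetric]
      by (intro centred_weight_Cons_dyck) (auto simp: words_def dyck_iff)
    then show "centred_weight t u v w (Suc c) (Up # p) = u * w * (centred_weight t u v w c p +
      (t - 1) * (if p \<in> ?hat then centred_weight t u v w c p else 0))"
      by (simp add: algebra_simps)
  qed
  also have "\<dots> = u * w * ((\<Sum>p\<in>?W. centred_weight t u v w c p) +
      (t - 1) * (\<Sum>p\<in>?W. if p \<in> ?hat then centred_weight t u v w c p else 0))"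
    by (simp add: sum_distrib_left sum.distrib distrib_left)
  also have "(\<Sum>p\<in>?W. if p \<in> ?hat then centred_weight t u v w c p else 0) =
      (\<Sum>p\<in>?hat. centred_weight t u v w c p)"
    using sub by (simp add: finite_words sum.If_cases Int_absorb1 Int_commute)
  also have "\<dots> = (\<Sum>p\<in>words (2 * c) 0 0. centred_weight t u v w c p)"
    by (subst sum.reindex)
      (auto simp: inj_on_def words_def centred_weight_snoc intro!: sum.cong)
  finally show ?thesis
    by (simp add: centred_sum_def)
qed

section \<open>First-return decomposition of Dyck paths\<close>

text \<open>
  All statistics of Dyck paths here are numbers of positions with some property, and this rule splits
  them along a concatenation.
\<close>

lemma card_less_add:
  fixes m n :: nat
  shows "card {i. i < m + n \<and> R i} = card {i. i < m \<and> R i} + card {i. i < n \<and> R (m + i)}"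
proof -
  have "{i. i < m + n \<and> R i} = {i. i < m \<and> R i} \<union> (+) m ` {i. i < n \<and> R (m + i)}"
  proof (intro set_eqI iffI)
    fix i assume "i \<in> {i. i < m + n \<and> R i}"
    then show "i \<in> {i. i < m \<and> R i} \<union> (+) m ` {i. i < n \<and> R (m + i)}"
      by (cases "i < m") (auto intro!: image_eqI[of _ _ "i - m"])
  qed auto
  moreover have "card ((+) m ` {i. i < n \<and> R (m + i)}) = card {i. i < n \<and> R (m + i)}"
    by (rule card_image) simp
  ultimately show ?thesis
    by (simp, subst card_Un_disjoint) auto
qed

lemma odd_ups_append:
    "odd_ups (p @ q) = odd_ups p + (if even (length p) then odd_ups q else even_ups q)"
  and even_ups_append:
    "even_ups (p @ q) = even_ups p + (if even (length p) then even_ups q else odd_ups q)"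
proof -
  have cong: "{i. i < length p \<and> (p @ q) ! i = Up \<and> R i} = {i. i < length p \<and> p ! i = Up \<and> R i}" for R
    by (auto simp: nth_append)
  show "odd_ups (p @ q) = odd_ups p + (if even (length p) then odd_ups q else even_ups q)"
    unfolding odd_ups_def even_ups_def length_append card_less_add cong by simp
  show "even_ups (p @ q) = even_ups p + (if even (length p) then even_ups q else odd_ups q)"
    unfolding odd_ups_def even_ups_def length_append card_less_add cong by simp
qed

lemma odd_ups_Nil [simp]: "odd_ups [] = 0" and even_ups_Nil [simp]: "even_ups [] = 0"
  by (simp_all add: odd_ups_def even_ups_def)

lemma odd_ups_Cons [simp]: "odd_ups (s # p) = of_bool (s = Up) + even_ups p"
proof -
  have "{i. i < length [s] \<and> [s] ! i = Up \<and> odd (i + 1)} = (if s = Up then {0} else {})"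
    by (auto simp: less_Suc_eq)
  then have "odd_ups [s] = of_bool (s = Up)"
    unfolding odd_ups_def by simp
  then show ?thesis
    using odd_ups_append[of "[s]" p] by simp
qed

lemma even_ups_Cons [simp]: "even_ups (s # p) = odd_ups p"
proof -
  have "{i. i < length [s] \<and> [s] ! i = Up \<and> even (i + 1)} = {}"
    by (auto simp: odd_pos)
  then have "even_ups [s] = 0"
    unfolding even_ups_def by simp
  then show ?thesis
    using even_ups_append[of "[s]" p] by simp
qed

lemma returns_append:
  assumes "height p = 0"
  shows "returns (p @ q) = returns p + returns q"
proof -
  have "{i. i < length p \<and> (p @ q) ! i = Down \<and> height (take (i + 1) (p @ q)) = 0} =
      {i. i < length p \<and> p ! i = Down \<and> height (take (i + 1) p) = 0}"
    by (auto simp: nth_append)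
  then show ?thesis
    unfolding returns_def length_append card_less_add using assms by simp
qed

text \<open>
  A hill cannot straddle the seam: its top would be the end point of \<open>p\<close>, which has height \<open>0\<close>.
\<close>

lemma hills_append:
  assumes "height p = 0"
  shows "hills (p @ q) = hills p + hills q"
proof -
  have hills_less: "hills r = card {i. i < length r \<and> i + 1 < length r \<and> r ! i = Up \<and>
      r ! (i + 1) = Down \<and> height (take (i + 1) r) = 1}" for r
    unfolding hills_def by (rule arg_cong[where f = card]) auto
  have inside: "i + 1 < length p" if "i < length p" "height (take (i + 1) (p @ q)) = 1" for i
    using that assms by (cases "i + 1 = length p") auto
  have "{i. i < length p \<and> i + 1 < length p + length q \<and> (p @ q) ! i = Up \<and>
        (p @ q) ! (i + 1) = Down \<and> height (take (i + 1) (p @ q)) = 1} =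
      {i. i < length p \<and> i + 1 < length p \<and> p ! i = Up \<and> p ! (i + 1) = Down \<and>
        height (take (i + 1) p) = 1}"
  proof (rule Collect_cong)
    fix i
    show "(i < length p \<and> i + 1 < length p + length q \<and> (p @ q) ! i = Up \<and>
        (p @ q) ! (i + 1) = Down \<and> height (take (i + 1) (p @ q)) = 1) \<longleftrightarrow>
      (i < length p \<and> i + 1 < length p \<and> p ! i = Up \<and> p ! (i + 1) = Down \<and>
        height (take (i + 1) p) = 1)"
    proof (cases "i + 1 < length p")
      case True
      then show ?thesis by (simp add: nth_append)
    next
      case False
      then show ?thesis using inside by blast
    qed
  qed
  moreover have "(p @ q) ! Suc (length p + i) = q ! Suc i" for i
    by (metis add_Suc_right nth_append_length_plus)
  ultimately show ?thesis
    unfolding hills_less length_append card_less_add using assms by simp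
qed

lemma dyck_height_take_nonneg: "dyck b \<Longrightarrow> i \<le> length b \<Longrightarrow> 0 \<le> height (take i b)"
  by (simp add: dyck_def)

lemma returns_arch:
  assumes "dyck b"
  shows "returns (Up # b @ [Down]) = 1"
proof -
  have "height b = 0"
    using assms by (simp add: dyck_def)
  have inside: "1 \<le> height (take (i + 1) (Up # b @ [Down]))" if "i \<le> length b" for i
    using that dyck_height_take_nonneg[OF assms, of i] by simp
  have "i = Suc (length b)" if "i < length (Up # b @ [Down])"
    "height (take (i + 1) (Up # b @ [Down])) = 0" for i
    using that inside[of i] by (cases "i \<le> length b") auto
  then have "{i. i < length (Up # b @ [Down]) \<and> (Up # b @ [Down]) ! i = Down \<and>
      height (take (i + 1) (Up # b @ [Down])) = 0} = {Suc (length b)}"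
    using \<open>height b = 0\<close> by auto
  then show ?thesis
    unfolding returns_def by simp
qed

lemma height_take_Suc: "i < length p \<Longrightarrow> height (take (Suc i) p) = height (take i p) + step_height (p ! i)"
  by (simp add: take_Suc_conv_app_nth)

text \<open>
  A peak whose top has height one must start on the axis. Inside the arch this is possible only
  if the whole path is that peak, since \<open>b\<close> stays at or above its own starting level.
\<close>

lemma hills_arch:
  assumes "dyck b"
  shows "hills (Up # b @ [Down]) = of_bool (b = [])"
proof -
  let ?p = "Up # b @ [Down]"
  have h0: "height b = 0"
    using assms by (simp add: dyck_def)
  have "i = 0 \<and> b = []" if "i + 1 < length ?p" "?p ! i = Up" "?p ! (i + 1) = Down"
    "height (take (i + 1) ?p) = 1" for i
  proof -
    have i: "i \<le> length b" "height (take i b) = 0"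
      using that by auto
    have "i = length b"
    proof (rule ccontr)
      assume "i \<noteq> length b"
      with i that have "i < length b" "b ! i = Down"
        by (auto simp: nth_append)
      then have "height (take (Suc i) b) = - 1"
        using i(2) by (simp add: height_take_Suc)
      with dyck_height_take_nonneg[OF assms, of "Suc i"] \<open>i < length b\<close> show False by simp
    qed
    moreover have "b = []"
    proof (rule ccontr)
      assume "b \<noteq> []"
      then obtain b' s where b: "b = b' @ [s]" by (cases b rule: rev_cases) auto
      with that(2) \<open>i = length b\<close> have "s = Up" by simp
      with h0 b have "height b' = - 1" by simp
      with dyck_height_take_nonneg[OF assms, of "length b'"] b show False by simp
    qed
    ultimately show ?thesis by simp
  qed
  then have "{i. i + 1 < length ?p \<and> ?p ! i = Up \<and> ?p ! (i + 1) = Down \<and>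
      height (take (i + 1) ?p) = 1} = (if b = [] then {0} else {})"
    by auto
  then show ?thesis
    unfolding hills_def by simp
qed

lemma dyck_paths_0: "dyck_paths 0 = {[]}"
  by (simp add: dyck_paths_eq_words words_0)

lemma bij_betw_first_return:
  "bij_betw (\<lambda>(i, b, c). Up # b @ Down # c)
     (SIGMA i:{0..n}. dyck_paths i \<times> dyck_paths (n - i)) (dyck_paths (Suc n))"
proof (rule bij_betw_imageI)
  show "inj_on (\<lambda>(i, b, c). Up # b @ Down # c) (SIGMA i:{0..n}. dyck_paths i \<times> dyck_paths (n - i))"
  proof (rule inj_onI, clarsimp)
    fix i b c i' b' c'
    assume "b @ Down # c = b' @ Down # c'" "b \<in> dyck_paths i" "b' \<in> dyck_paths i'"
    then show "i = i' \<and> b = b' \<and> c = c'"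
      using first_unmatched_Down_unique[of b c b' c'] by (auto simp: dyck_paths_def)
  qed
  show "(\<lambda>(i, b, c). Up # b @ Down # c) ` (SIGMA i:{0..n}. dyck_paths i \<times> dyck_paths (n - i)) =
      dyck_paths (Suc n)"
  proof (intro set_eqI iffI)
    fix p assume "p \<in> (\<lambda>(i, b, c). Up # b @ Down # c) `
      (SIGMA i:{0..n}. dyck_paths i \<times> dyck_paths (n - i))"
    then show "p \<in> dyck_paths (Suc n)"
      by (auto simp: dyck_paths_def dyck_iff deficit_append surplus_append)
  next
    fix p assume p: "p \<in> dyck_paths (Suc n)"
    then obtain s q where q: "p = s # q" by (cases p) (auto simp: dyck_paths_def)
    with p have "s = Up" "deficit q = 1"
      by (auto simp: dyck_paths_def dyck_iff split: step.splits if_splits)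
    then obtain b c where bc: "q = b @ Down # c" "dyck b"
      using first_unmatched_Down[of q] by auto
    with p q have "dyck c"
      by (auto simp: dyck_paths_def dyck_iff deficit_append surplus_append split: step.splits if_splits)
    have "even (length b)"
    proof -
      have "even (height r) \<longleftrightarrow> even (length r)" for r
      proof (induction r)
        case (Cons s r)
        then show ?case by (cases s) auto
      qed simp
      from this[of b] show ?thesis
        using bc(2) by (simp add: dyck_def)
    qed
    then obtain i where i: "length b = 2 * i" by (auto elim: evenE)
    with p q bc have "length c = 2 * (n - i)" "i \<le> n"
      by (auto simp: dyck_paths_def)
    then show "p \<in> (\<lambda>(i, b, c). Up # b @ Down # c) `
      (SIGMA i:{0..n}. dyck_paths i \<times> dyck_paths (n - i))"
      using q bc \<open>s = Up\<close> \<open>dyck c\<close> i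
      by (intro image_eqI[of _ _ "(i, b, c)"]) (auto simp: dyck_paths_def)
  qed
qed

lemma hill_gf_0 [simp]: "hill_gf t u v w $ 0 = 1"
proof -
  have "hills [] = 0" "returns [] = 0"
    by (simp_all add: hills_def returns_def)
  then show ?thesis
    by (simp add: hill_gf_def dyck_paths_0)
qed

text \<open>
  Write a nonempty Dyck path as \<open>Up # b @ Down # c\<close>. In \<open>b\<close> odd and even positions are exchanged, hence
  \<open>hill_gf 1 v u 1\<close>, and no hill or return of \<open>b\<close> counts. The arch is a hill precisely if \<open>b\<close> is
  empty, which replaces the constant term \<open>1\<close> of that series by \<open>t\<close>. In \<open>c\<close> nothing changes.
\<close>

lemma hill_gf_first_return:
  fixes t u v w :: "'a::comm_ring_1"
  shows "hill_gf t u v w = 1 + fps_const (u * w) * fps_X *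
     ((hill_gf 1 v u 1 + fps_const (t - 1)) * hill_gf t u v w)"
proof (rule fps_ext)
  fix n
  let ?wt = "\<lambda>p. t ^ hills p * u ^ odd_ups p * v ^ even_ups p * w ^ returns p"
  let ?in = "\<lambda>p. v ^ odd_ups p * u ^ even_ups p"
  show "hill_gf t u v w $ n = (1 + fps_const (u * w) * fps_X *
     ((hill_gf 1 v u 1 + fps_const (t - 1)) * hill_gf t u v w)) $ n"
  proof (cases n)
    case 0
    then show ?thesis by simp
  next
    case (Suc m)
    have wt: "?wt (Up # b @ Down # c) = u * w * ((if b = [] then t else 1) * ?in b * ?wt c)"
      if "b \<in> dyck_paths i" for i b c
    proof -
      from that have b: "dyck b" "length b = 2 * i" by (auto simp: dyck_paths_def)
      then have "height (Up # b @ [Down]) = 0"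
        by (simp add: dyck_def)
      from returns_append[OF this, of c] hills_append[OF this, of c]
      show ?thesis
        using b(2) by (simp add: returns_arch[OF b(1)] hills_arch[OF b(1)] odd_ups_append
            even_ups_append power_add mult_ac)
    qed
    have inner: "(\<Sum>b\<in>dyck_paths i. (if b = [] then t else 1) * ?in b) =
        (hill_gf 1 v u 1 + fps_const (t - 1)) $ i" for i
    proof (cases i)
      case 0
      then show ?thesis
        by (simp add: dyck_paths_0)
    next
      case (Suc j)
      then have "b \<noteq> []" if "b \<in> dyck_paths i" for b
        using that by (auto simp: dyck_paths_def)
      then have "(\<Sum>b\<in>dyck_paths i. (if b = [] then t else 1) * ?in b) =
          (\<Sum>b\<in>dyck_paths i. ?in b)"
        by (intro sum.cong) auto
      then show ?thesis
        using Suc by (simp add: hill_gf_def)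
    qed
    have "hill_gf t u v w $ n = (\<Sum>p\<in>dyck_paths (Suc m). ?wt p)"
      using Suc by (simp add: hill_gf_def)
    also have "\<dots> = (\<Sum>(i, b, c)\<in>(SIGMA i:{0..m}. dyck_paths i \<times> dyck_paths (m - i)).
        ?wt (Up # b @ Down # c))"
      by (subst sum.reindex_bij_betw[OF bij_betw_first_return, symmetric])
        (simp add: case_prod_unfold)
    also have "\<dots> = (\<Sum>i=0..m. \<Sum>b\<in>dyck_paths i. \<Sum>c\<in>dyck_paths (m - i). ?wt (Up # b @ Down # c))"
      by (simp add: sum.Sigma sum.cartesian_product finite_dyck_paths case_prod_unfold)
    also have "\<dots> = (\<Sum>i=0..m. \<Sum>b\<in>dyck_paths i. \<Sum>c\<in>dyck_paths (m - i).
        u * w * ((if b = [] then t else 1) * ?in b * ?wt c))"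
      by (intro sum.cong refl wt)
    also have "\<dots> = u * w * (\<Sum>i=0..m. (\<Sum>b\<in>dyck_paths i. (if b = [] then t else 1) * ?in b) *
        (\<Sum>c\<in>dyck_paths (m - i). ?wt c))"
      unfolding sum_product by (simp only: sum_distrib_left)
    also have "\<dots> = u * w * ((hill_gf 1 v u 1 + fps_const (t - 1)) * hill_gf t u v w) $ m"
      unfolding fps_mult_nth inner by (simp add: hill_gf_def)
    finally show ?thesis
      using Suc by (simp add: mult.assoc)
  qed
qed

lemma catalan_gf_eq_hill_gf: "catalan_gf = hill_gf 1 1 1 1"
  by (simp add: catalan_gf_def hill_gf_def)

section \<open>Paths from a given height down to the axis\<close>

text \<open>
  Paths from height \<open>h\<close> to the axis, cut at their first descent below each of the levels \<open>h, ..., 1\<close>.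
  The pieces are Dyck paths raised to the levels \<open>h, ..., 0\<close>. A step is in odd position if the number of
  remaining steps, itself included, is even. So the pieces at even levels start in odd position and
  those at odd levels in even position; only the last piece, at level \<open>0\<close>, has hills and returns.
  The exponent of the series variable is half of the length minus \<open>h\<close>.
\<close>

definition path_gf :: "'a::comm_ring_1 \<Rightarrow> 'a \<Rightarrow> 'a \<Rightarrow> 'a \<Rightarrow> nat \<Rightarrow> 'a fps" where
  "path_gf t u v w h =
     hill_gf t u v w * hill_gf 1 u v 1 ^ (h div 2) * hill_gf 1 v u 1 ^ (Suc h div 2)"

lemma path_gf_0_rec:
  "path_gf t u v w 0 = 1 + fps_const (u * w) * fps_X *
     (path_gf t u v w 1 + fps_const (t - 1) * path_gf t u v w 0)"
  using hill_gf_first_return[of t u v w] by (simp add: path_gf_def algebra_simps)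

lemma path_gf_Suc_rec:
  "path_gf t u v w (Suc h) = path_gf t u v w h +
     fps_const (if even (Suc h) then u else v) * fps_X * path_gf t u v w (Suc (Suc h))"
proof -
  define g g1 g2 where "g = hill_gf t u v w" and "g1 = hill_gf 1 u v 1" and "g2 = hill_gf 1 v u 1"
  have g1: "g1 = 1 + fps_const u * fps_X * (g1 * g2)"
    using hill_gf_first_return[of 1 u v 1] by (simp add: g1_def g2_def mult_ac)
  have g2: "g2 = 1 + fps_const v * fps_X * (g1 * g2)"
    using hill_gf_first_return[of 1 v u 1] by (simp add: g1_def g2_def mult_ac)
  show ?thesis
  proof (cases "even h")
    case True
    then obtain k where k: "h = 2 * k" by (auto elim: evenE)
    have "path_gf t u v w (Suc h) = g * g1 ^ k * g2 ^ k * g2"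
      by (simp add: path_gf_def g_def g1_def g2_def k mult_ac)
    also have "\<dots> = g * g1 ^ k * g2 ^ k * (1 + fps_const v * fps_X * (g1 * g2))"
      by (simp only: g2[symmetric])
    also have "\<dots> = path_gf t u v w h +
        fps_const (if even (Suc h) then u else v) * fps_X * path_gf t u v w (Suc (Suc h))"
      by (simp add: path_gf_def g_def g1_def g2_def k algebra_simps)
    finally show ?thesis .
  next
    case False
    then obtain k where k: "h = 2 * k + 1" by (auto elim: oddE)
    have "path_gf t u v w (Suc h) = g * g1 ^ k * g2 ^ Suc k * g1"
      by (simp add: path_gf_def g_def g1_def g2_def k mult_ac)
    also have "\<dots> = g * g1 ^ k * g2 ^ Suc k * (1 + fps_const u * fps_X * (g1 * g2))"
      by (simp only: g1[symmetric])
    also have "\<dots> = path_gf t u v w h +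
        fps_const (if even (Suc h) then u else v) * fps_X * path_gf t u v w (Suc (Suc h))"
      by (simp add: path_gf_def g_def g1_def g2_def k algebra_simps)
    finally show ?thesis .
  qed
qed

lemma fps_const_X_mult_nth:
  "(fps_const (x :: 'a::comm_ring_1) * fps_X * f) $ m = (if m = 0 then 0 else x * f $ (m - 1))"
  by (simp add: mult.assoc)

text \<open>
  The sum over words depends on \<open>a\<close> and \<open>b\<close> only through \<open>a + b\<close>: the recursions obtained by reading
  words alternately from the left and from the right are the recursions of the series of paths
  from height \<open>a + b\<close>. For \<open>a = b = 0\<close> this is the equidistribution of centred, left and right
  tunnels and centred multitunnels with hills, odd and even up-steps and returns.
\<close>

lemma centred_sum_eq_path_gf:
  "l = a + b + 2 * m \<Longrightarrow> centred_sum t u v w l a b = path_gf t u v w (a + b) $ m"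
proof (induction l arbitrary: a b m rule: less_induct)
  case (less l)
  \<comment> \<open>For \<open>m = 0\<close> all steps are unmatched, and no word begins or ends with a matched step.\<close>
  have up: "centred_sum t u v w l' a' b' = (if m = 0 then 0 else path_gf t u v w (Suc (a + b)) $ (m - 1))"
    if "l = Suc l'" "a' + b' = Suc (a + b)" for l' a' b'
  proof (cases m)
    case 0
    with that less.prems have "l' < a' + b'" by simp
    then show ?thesis using 0 by (simp add: centred_sum_def words_empty)
  next
    case (Suc k)
    with that less.prems have "l' < l" "l' = a' + b' + 2 * k" by auto
    from less.IH[OF this] Suc that(2) show ?thesis by simp
  qed
  show ?case
  proof (cases "a + b = 0")
    case True
    show ?thesis
    proof (cases m)
      case 0
      with True less.prems show ?thesis
        by (simp add: centred_sum_def words_0 path_gf_def)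
    next
      case (Suc k)
      from True have ab: "a = 0" "b = 0" by simp_all
      have l: "l = Suc (Suc (2 * k))"
        unfolding less.prems ab Suc by simp
      have IH: "centred_sum t u v w (Suc (2 * k)) 1 0 = path_gf t u v w 1 $ k"
          "centred_sum t u v w (2 * k) 0 0 = path_gf t u v w 0 $ k"
        by (subst less.IH[where m = k]; simp add: l)+
      have "path_gf t u v w 0 $ m = u * w * (path_gf t u v w 1 $ k + (t - 1) * path_gf t u v w 0 $ k)"
        by (subst path_gf_0_rec) (simp add: fps_const_X_mult_nth Suc)
      then show ?thesis
        unfolding l ab centred_sum_Cons_dyck IH by simp
    qed
  next
    case False
    then obtain h where h: "a + b = Suc h" by (cases "a + b") auto
    with less.prems obtain l' where l: "l = Suc l'" by (cases l) auto
    have down: "centred_sum t u v w l' a' b' = path_gf t u v w h $ m" if "a' + b' = h" for a' b'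
    proof -
      from that less.prems l h have "l' < l" "l' = a' + b' + 2 * m" by auto
      from less.IH[OF this] that show ?thesis by simp
    qed
    have rec: "path_gf t u v w (a + b) $ m = path_gf t u v w h $ m + (if m = 0 then 0
        else (if even (Suc h) then u else v) * path_gf t u v w (Suc (a + b)) $ (m - 1))"
      unfolding h by (subst path_gf_Suc_rec) (simp add: fps_const_X_mult_nth)
    show ?thesis
    proof (cases "even l'")
      case True
      then have "odd (Suc h)"
        using less.prems l h by auto
      then show ?thesis
        unfolding rec l using \<open>a + b \<noteq> 0\<close> True h
        by (subst centred_sum_snoc) (auto simp: up[OF l] down)
    next
      case False
      then have "even (Suc h)"
        using less.prems l h by (auto simp: even_Suc)
      then show ?thesis
        unfolding rec l using \<open>a + b \<noteq> 0\<close> False h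
        by (subst centred_sum_Cons) (auto simp: up[OF l] down)
    qed
  qed
qed

section \<open>Centres to the right of the middle\<close>

text \<open>
  Multiplication by \<open>fps_X ^ k\<close> turns the exponent into half of the length, and its coefficient vanishes
  if the words are too short for \<open>2 * k\<close> unmatched steps.
\<close>

lemma centred_sum_even:
  assumes "a + b = 2 * k"
  shows "centred_sum t u v w (2 * m) a b = (path_gf t u v w (2 * k) * fps_X ^ k) $ m"
proof (cases "m < k")
  case True
  with assms show ?thesis
    by (simp add: centred_sum_def words_empty fps_X_power_mult_right_nth)
next
  case False
  with assms have "2 * m = a + b + 2 * (m - k)" by simp
  from centred_sum_eq_path_gf[OF this] False assms show ?thesis
    by (simp add: fps_X_power_mult_right_nth)
qed

text \<open>
  With all weights equal to one, the sums over words count words, and those of deficit zero are the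
  prefixes of Dyck paths.
\<close>

lemma card_prefixes_of_height:
  "of_nat (card (words (2 * r) 0 (2 * k))) = (catalan_gf ^ (2 * k + 1) * fps_X ^ k :: 'a::comm_ring_1 fps) $ r"
proof -
  have "(of_nat (card (words (2 * r) 0 (2 * k))) :: 'a) = centred_sum 1 1 1 1 (2 * r) 0 (2 * k)"
    by (simp add: centred_sum_def centred_weight_def)
  also have "\<dots> = (path_gf 1 1 1 1 (2 * k) * fps_X ^ k) $ r"
    by (rule centred_sum_even) simp
  also have "path_gf 1 1 1 1 (2 * k) = (catalan_gf ^ (2 * k + 1) :: 'a fps)"
    by (simp add: path_gf_def catalan_gf_eq_hill_gf mult_2 power_add mult.assoc)
  finally show ?thesis .
qed

lemma twice_count_Up: "2 * int (count_list p Up) = int (length p) + height p"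
proof (induction p)
  case (Cons s p)
  then show ?case by (cases s) auto
qed simp

text \<open>
  The height after an even number of steps is even, so it is written as \<open>2 * k\<close>.
\<close>

lemma bij_betw_split_dyck:
  assumes "r \<le> n"
  shows "bij_betw (\<lambda>(k, p, q). p @ q)
    (SIGMA k:{..n}. words (2 * r) 0 (2 * k) \<times> words (2 * (n - r)) (2 * k) 0) (dyck_paths n)"
proof (rule bij_betw_imageI)
  let ?S = "SIGMA k:{..n}. words (2 * r) 0 (2 * k) \<times> words (2 * (n - r)) (2 * k) 0"
  show "inj_on (\<lambda>(k, p, q). p @ q) ?S"
    by (auto simp: inj_on_def words_def)
  show "(\<lambda>(k, p, q). p @ q) ` ?S = dyck_paths n"
  proof (intro set_eqI iffI)
    fix d assume "d \<in> (\<lambda>(k, p, q). p @ q) ` ?S"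
    then show "d \<in> dyck_paths n"
      using assms by (auto simp: dyck_paths_eq_words words_def deficit_append surplus_append)
  next
    fix d assume d: "d \<in> dyck_paths n"
    define p q where "p = take (2 * r) d" and "q = drop (2 * r) d"
    then have dpq: "d = p @ q" by simp
    have len: "length p = 2 * r" "length q = 2 * (n - r)"
      using d assms by (auto simp: p_def q_def dyck_paths_def)
    have shape: "deficit p = 0" "surplus q = 0" "deficit q = surplus p"
      using d unfolding dpq by (auto simp: dyck_paths_eq_words words_def deficit_append surplus_append)
    have "2 * int (count_list p Up) = 2 * int r + int (surplus p)"
      using twice_count_Up[of p] len shape by (simp add: height_eq)
    then have "even (int (surplus p))"
      by presburger
    then have "even (surplus p)"
      by simp
    then obtain k where k: "surplus p = 2 * k"
      by (auto elim: evenE)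
    moreover have "k \<le> n"
      using deficit_surplus_le_length[of p] k len assms by simp
    ultimately show "d \<in> (\<lambda>(k, p, q). p @ q) ` ?S"
      using dpq len shape by (intro image_eqI[of _ _ "(k, p, q)"]) (auto simp: words_def)
  qed
qed

text \<open>
  A centre at \<open>n + r\<close> is the middle of the suffix that remains after the first \<open>2 * r\<close> steps. A prefix that
  ends at height \<open>2 * k\<close> has \<open>r + k\<close> up-steps, each worth a factor \<open>u\<close>: those that are matched
  inside the prefix and also the \<open>2 * k\<close> others, whose tunnels end in the suffix. This leaves the suffix,
  with \<open>2 * k\<close> unmatched down-steps, weighted about its own middle.
\<close>

lemma sum_centred_weight_dyck_paths:
  fixes t u v w :: "'a::comm_ring_1"
  assumes "r \<le> n"
  shows "(\<Sum>d\<in>dyck_paths n. centred_weight t u v w (n + r) d) =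
    (\<Sum>k\<le>n. u ^ (r + k) * (catalan_gf ^ (2 * k + 1) * fps_X ^ k) $ r *
      (path_gf t u v w (2 * k) * fps_X ^ k) $ (n - r))"
proof -
  have wt: "centred_weight t u v w (n + r) (p @ q) = u ^ (r + k) * centred_weight t u v w (n - r) q"
    if "p \<in> words (2 * r) 0 (2 * k)" "q \<in> words (2 * (n - r)) (2 * k) 0" for k p q
  proof -
    have "2 * int (count_list p Up) = 2 * int r + 2 * int k"
      using twice_count_Up[of p] that by (simp add: height_eq words_def)
    then have "count_list p Up = r + k" by simp
    moreover have "length p + (n - r) = n + r"
      using that assms by (simp add: words_def)
    ultimately show ?thesis
      using centred_weight_append[of q "n - r" p t u v w] that
      by (simp add: words_def surplus_append)
  qed
  have "(\<Sum>d\<in>dyck_paths n. centred_weight t u v w (n + r) d) =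
      (\<Sum>(k, p, q)\<in>(SIGMA k:{..n}. words (2 * r) 0 (2 * k) \<times> words (2 * (n - r)) (2 * k) 0).
        centred_weight t u v w (n + r) (p @ q))"
    by (subst sum.reindex_bij_betw[OF bij_betw_split_dyck[OF assms], symmetric])
      (simp add: case_prod_unfold)
  also have "\<dots> = (\<Sum>k\<le>n. \<Sum>p\<in>words (2 * r) 0 (2 * k). \<Sum>q\<in>words (2 * (n - r)) (2 * k) 0.
      centred_weight t u v w (n + r) (p @ q))"
    by (simp add: sum.Sigma sum.cartesian_product finite_words case_prod_unfold)
  also have "\<dots> = (\<Sum>k\<le>n. \<Sum>p\<in>words (2 * r) 0 (2 * k). \<Sum>q\<in>words (2 * (n - r)) (2 * k) 0.
      u ^ (r + k) * centred_weight t u v w (n - r) q)"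
    by (intro sum.cong refl wt)
  also have "\<dots> = (\<Sum>k\<le>n. u ^ (r + k) * of_nat (card (words (2 * r) 0 (2 * k))) *
      centred_sum t u v w (2 * (n - r)) (2 * k) 0)"
    by (simp add: centred_sum_def sum_distrib_left mult_ac)
  also have "\<dots> = (\<Sum>k\<le>n. u ^ (r + k) * (catalan_gf ^ (2 * k + 1) * fps_X ^ k) $ r *
      (path_gf t u v w (2 * k) * fps_X ^ k) $ (n - r))"
    unfolding card_prefixes_of_height using centred_sum_even[of _ 0, where t = t and u = u and v = v and w = w]
    by simp
  finally show ?thesis .
qed

lemma tunnel_gf_nth:
  fixes t u v w y :: "'a::comm_ring_1"
  shows "tunnel_gf t u v w y $ n =
    (\<Sum>r=0..n. y ^ r * (\<Sum>d\<in>dyck_paths n. centred_weight t u v w (n + r) d))"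
proof -
  have "semilength d = n" if "d \<in> dyck_paths n" for d
    using that by (simp add: dyck_paths_def semilength_def)
  then show ?thesis
    by (simp add: tunnel_gf_def centred_weight_def tunnel_count_def multitunnel_count_def
        tunnels_at_def tunnels_upto_def tunnels_beyond_def multitunnels_at_def
        sum_distrib_left mult_ac)
qed

text \<open>
  For fixed \<open>k\<close>, the summation over \<open>r\<close> is a product of power series. The factor \<open>u ^ r * y ^ r\<close>
  belongs to the prefix and is absorbed by substituting \<open>u * y * z\<close> in the series of prefixes. The
  result is the \<open>k\<close>-th term of a geometric series.
\<close>

lemma tunnel_gf_nth_eq_geometric:
  fixes t u v w y :: "'a::idom"
  defines "C \<equiv> catalan_gf oo (fps_const (u * y) * fps_X)"
  shows "tunnel_gf t u v w y $ n =
    (\<Sum>k\<le>n. C * hill_gf t u v w * (fps_const (y * u ^ 2) * fps_X ^ 2 * C ^ 2 *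
       hill_gf 1 u v 1 * hill_gf 1 v u 1) ^ k) $ n"
proof -
  let ?L = "fps_const (u * y) * fps_X :: 'a fps"
  let ?N = "\<lambda>k. catalan_gf ^ (2 * k + 1) * fps_X ^ k :: 'a fps"
  let ?Q = "\<lambda>k. path_gf t u v w (2 * k) * fps_X ^ k"
  have N: "?N k oo ?L = C ^ (2 * k + 1) * ?L ^ k" for k
    by (simp add: C_def fps_compose_mult_distrib fps_compose_power[symmetric])
  have conv: "(fps_const c * ((f oo ?L) * g)) $ n =
      (\<Sum>r=0..n. c * ((u * y) ^ r * f $ r * g $ (n - r)))" for c f g
    by (simp add: fps_compose_linear fps_mult_nth[of "Abs_fps _"] sum_distrib_left)
  have "tunnel_gf t u v w y $ n =
      (\<Sum>r=0..n. y ^ r * (\<Sum>k\<le>n. u ^ (r + k) * ?N k $ r * ?Q k $ (n - r)))"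
    unfolding tunnel_gf_nth
    by (intro sum.cong refl arg_cong2[where f = "(*)"] sum_centred_weight_dyck_paths) simp
  also have "\<dots> = (\<Sum>k\<le>n. \<Sum>r=0..n. u ^ k * ((u * y) ^ r * ?N k $ r * ?Q k $ (n - r)))"
    unfolding sum_distrib_left
    by (subst sum.swap) (intro sum.cong refl, simp add: power_add power_mult_distrib mult_ac)
  also have "\<dots> = (\<Sum>k\<le>n. (fps_const (u ^ k) * ((?N k oo ?L) * ?Q k)) $ n)"
    unfolding conv by (rule refl)
  also have "\<dots> = (\<Sum>k\<le>n. (C * hill_gf t u v w * (fps_const (y * u ^ 2) * fps_X ^ 2 * C ^ 2 *
       hill_gf 1 u v 1 * hill_gf 1 v u 1) ^ k) $ n)"
  proof (intro sum.cong refl arg_cong[where f = "\<lambda>f. f $ n"])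
    fix k
    \<comment> \<open>Splitting constants into powers of single variables turns both sides into the same monomial.\<close>
    have "fps_const (u ^ k) = (fps_const u :: 'a fps) ^ k"
      by (simp add: fps_const_power)
    moreover have "?L = fps_const u * fps_const y * fps_X"
      "fps_const (y * u ^ 2) = (fps_const y * fps_const u ^ 2 :: 'a fps)"
      by (simp_all add: fps_const_mult fps_const_power)
    ultimately show "fps_const (u ^ k) * ((?N k oo ?L) * ?Q k) =
        C * hill_gf t u v w * (fps_const (y * u ^ 2) * fps_X ^ 2 * C ^ 2 *
       hill_gf 1 u v 1 * hill_gf 1 v u 1) ^ k"
      unfolding N path_gf_def
      by (simp add: power_mult_distrib power_mult[symmetric] mult_2 mult_2_right power_add mult_ac
          del: fps_const_mult fps_const_power)
  qed
  finally show ?thesis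
    by (simp add: fps_sum_nth)
qed

text \<open>
  As \<open>q\<close> has no constant term, the terms beyond the \<open>n\<close>-th of the geometric series do not contribute
  to the coefficient of \<open>z ^ n\<close>.
\<close>

lemma fps_geometric_nth:
  fixes f q :: "'a::field fps"
  assumes "q $ 0 = 0"
  shows "(f / (1 - q)) $ n = (\<Sum>k\<le>n. f * q ^ k) $ n"
proof -
  define R where "R = f / (1 - q)"
  have R: "R * (1 - q) = f"
    unfolding R_def by (rule dvd_div_mult_self) (simp add: assms unit_imp_dvd)
  have "f * (\<Sum>k\<le>n. q ^ k) = R * ((1 - q) * (\<Sum>k\<le>n. q ^ k))"
    using R by (simp add: mult.assoc[symmetric])
  also have "\<dots> = R - q ^ Suc n * R"
    unfolding sum_gp_basic by (simp add: algebra_simps)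
  finally have "R = (\<Sum>k\<le>n. f * q ^ k) + q ^ Suc n * R"
    by (simp add: sum_distrib_left)
  moreover have "(q ^ Suc n * R) $ n = 0"
    unfolding fps_mult_nth using assms
    by (intro sum.neutral) (auto simp: startsby_zero_power_prefix simp del: power_Suc)
  ultimately show ?thesis
    unfolding R_def by (metis add.right_neutral fps_add_nth)
qed

lemma tunnel_gf_eq:
  fixes t u v w y :: "'a::field"
  defines "C \<equiv> catalan_gf oo (fps_const u * fps_const y * fps_X)"
  shows "tunnel_gf t u v w y = C * hill_gf t u v w /
    (1 - fps_const y * fps_const u ^ 2 * fps_X ^ 2 * C ^ 2 * hill_gf 1 u v 1 * hill_gf 1 v u 1)"
proof (rule fps_ext)
  fix n
  let ?q = "fps_const y * fps_const u ^ 2 * fps_X ^ 2 * C ^ 2 * hill_gf 1 u v 1 * hill_gf 1 v u 1"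
  have "?q $ 0 = 0"
    by simp
  from fps_geometric_nth[OF this, of "C * hill_gf t u v w" n]
  show "tunnel_gf t u v w y $ n = (C * hill_gf t u v w / (1 - ?q)) $ n"
    using tunnel_gf_nth_eq_geometric[of t u v w y n]
    by (simp add: C_def)
qed

section \<open>Closed forms\<close>

lemma catalan_gf_compose_rec:
  fixes x :: "'a::idom fps"
  assumes "x $ 0 = 0"
  shows "catalan_gf oo x = 1 + x * (catalan_gf oo x) ^ 2"
proof -
  have "catalan_gf = 1 + fps_X * (catalan_gf :: 'a fps) ^ 2"
    using hill_gf_first_return[of "1::'a" 1 1 1]
    by (simp add: catalan_gf_eq_hill_gf power2_eq_square)
  then have "catalan_gf oo x = (1 + fps_X * catalan_gf ^ 2) oo x"
    by simp
  also have "\<dots> = 1 + x * (catalan_gf oo x) ^ 2"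
    using assms
    by (simp add: fps_compose_add_distrib fps_compose_mult_distrib fps_compose_power[symmetric])
  finally show ?thesis .
qed

text \<open>
  Completing the square in the quadratic equation of the Catalan series.
\<close>

lemma fps_sqrt_catalan:
  fixes x :: "'a::field_char_0 fps"
  assumes "x $ 0 = 0"
  shows "fps_sqrt (1 - 4 * x) = 1 - 2 * x * (catalan_gf oo x)"
proof -
  let ?C = "catalan_gf oo x"
  have "(1 - 2 * x * ?C) ^ 2 = 1 - 4 * x * (?C - x * ?C ^ 2)"
    by (simp add: power2_eq_square algebra_simps)
  also have "?C - x * ?C ^ 2 = 1"
    using catalan_gf_compose_rec[OF assms] by (simp add: algebra_simps)
  finally have "(1 - 2 * x * ?C) ^ 2 = 1 - 4 * x"
    by simp
  then show ?thesis
    using fps_sqrt_unique[of "1 - 4 * x" "1 - 2 * x * ?C"] assms by simp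
qed

text \<open>
  Exchanging \<open>u\<close> and \<open>v\<close> gives the companion equation, with the same product on the right. Between
  them, each of the two series satisfies a quadratic equation.
\<close>

lemma hill_gf_odd_even_rec:
  fixes u v :: "'a::comm_ring_1"
  shows "hill_gf 1 u v 1 = 1 + fps_const u * fps_X * (hill_gf 1 u v 1 * hill_gf 1 v u 1)"
  using hill_gf_first_return[of 1 u v 1] by (simp add: mult_ac)

text \<open>
  The square root of the discriminant of the quadratic equation for \<open>hill_gf 1 v u 1\<close>; the constant
  term selects the branch.
\<close>

lemma fps_sqrt_discriminant:
  fixes u v :: "'a::field_char_0"
  defines "U \<equiv> fps_const u" and "V \<equiv> fps_const v"
  shows "fps_sqrt (1 - 2 * (U + V) * fps_X + (U - V) ^ 2 * fps_X ^ 2) =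
    1 + (U - V) * fps_X - 2 * U * fps_X * hill_gf 1 v u 1"
proof -
  define g1 g2 where "g1 = hill_gf 1 u v 1" and "g2 = hill_gf 1 v u 1"
  have "g1 = 1 + U * fps_X * (g1 * g2)" and "g2 = 1 + V * fps_X * (g1 * g2)"
    using hill_gf_odd_even_rec[of u v] hill_gf_odd_even_rec[of v u]
    by (simp_all add: g1_def g2_def U_def V_def mult_ac)
  then have "(1 + (U - V) * fps_X - 2 * U * fps_X * g2) ^ 2 =
      1 - 2 * (U + V) * fps_X + (U - V) ^ 2 * fps_X ^ 2"
    by algebra
  moreover have "(1 + (U - V) * fps_X - 2 * U * fps_X * g2) $ 0 = 1"
    "(1 - 2 * (U + V) * fps_X + (U - V) ^ 2 * fps_X ^ 2) $ 0 = 1"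
    by simp_all
  ultimately show ?thesis
    unfolding g2_def using fps_sqrt_unique by metis
qed

text \<open>
  For the closed form, both factors of the denominator are recognised as inverses of known series. The
  first is \<open>2 / hill_gf t u v w\<close> by the first-return equation. The second is a multiple of
  \<open>1 - U * Z * hill_gf 1 v u 1 * C\<close>, which is \<open>1 / hill_gf 1 u v 1\<close> times the denominator of the geometric
  series. The common factor \<open>- 8 * U * Y * Z\<close> of numerator and denominator is nonzero if \<open>u\<close> and \<open>y\<close> are.
\<close>

theorem theorem6:
  fixes t u v w y :: "'a::field_char_0"
  shows
    "let T = fps_const t; U = fps_const u; V = fps_const v; W = fps_const w;
         Y = fps_const y; Z = fps_X;
         C = fps_compose catalan_gf (U * Y * Z);
         A = fps_sqrt (1 - 2 * (U + V) * Z + (U - V) ^ 2 * Z ^ 2) - 1;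
         B = fps_sqrt (1 - 4 * U * Y * Z) - 1;
         E = C * hill_gf t u v w /
               (1 - Y * U ^ 2 * Z ^ 2 * C ^ 2 * hill_gf 1 u v 1 * hill_gf 1 v u 1)
     in tunnel_gf t u v w y = E \<and>
        (u \<noteq> 0 \<and> y \<noteq> 0 \<longrightarrow>
          E = 2 * B * (2 + (V - U) * Z + A) /
                ((2 + (U + V - 2 * T * U) * W * Z + W * A) *
                 ((A + (V - U) * Z) * B - 4 * U * Y * Z)))"
proof -
  define T U V W Y Z where "T = fps_const t" and "U = fps_const u" and "V = fps_const v"
    and "W = fps_const w" and "Y = fps_const y" and "Z = (fps_X :: 'a fps)"
  note vars = T_def U_def V_def W_def Y_def Z_def
  define C where "C = catalan_gf oo (U * Y * Z)"
  define A where "A = fps_sqrt (1 - 2 * (U + V) * Z + (U - V) ^ 2 * Z ^ 2) - 1"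
  define B where "B = fps_sqrt (1 - 4 * U * Y * Z) - 1"
  define g g1 g2 where "g = hill_gf t u v w" and "g1 = hill_gf 1 u v 1" and "g2 = hill_gf 1 v u 1"
  define q where "q = Y * U ^ 2 * Z ^ 2 * C ^ 2 * g1 * g2"
  define E where "E = C * g / (1 - q)"
  have gf: "tunnel_gf t u v w y = E"
    unfolding E_def q_def C_def g_def g1_def g2_def vars by (rule tunnel_gf_eq)
  have "E = 2 * B * (2 + (V - U) * Z + A) /
      ((2 + (U + V - 2 * T * U) * W * Z + W * A) * ((A + (V - U) * Z) * B - 4 * U * Y * Z))"
    (is "_ = ?num / ?den") if nz: "u \<noteq> 0" "y \<noteq> 0"
  proof -
    define d where "d = 1 - W * U * Z * (g2 + T - 1)"
    define d1 where "d1 = 1 - U * Z * g2"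
    have C: "C = 1 + U * Y * Z * C ^ 2"
      unfolding C_def vars by (rule catalan_gf_compose_rec) simp
    have "g1 = 1 + U * Z * (g1 * g2)"
      unfolding g1_def g2_def vars by (rule hill_gf_odd_even_rec)
    then have d1: "d1 * g1 = 1"
      unfolding d1_def by algebra
    have "g = 1 + fps_const (u * w) * Z * ((g2 + fps_const (t - 1)) * g)"
      unfolding g_def g2_def vars by (rule hill_gf_first_return)
    moreover have "fps_const (u * w) = U * W" "fps_const (t - 1) = T - 1"
      by (simp_all add: vars fps_const_sub flip: fps_const_1_eq_1)
    ultimately have d: "d * g = 1"
      unfolding d_def by algebra
    have A: "A = (U - V) * Z - 2 * U * Z * g2"
      unfolding A_def g2_def vars fps_sqrt_discriminant by simp
    have B: "B = - 2 * U * Y * Z * C"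
      using fps_sqrt_catalan[of "U * Y * Z"] unfolding B_def C_def
      by (simp add: mult.assoc vars)
    have R: "E * (1 - q) = C * g"
      unfolding E_def
      by (rule dvd_div_mult_self) (simp add: q_def vars unit_imp_dvd)
    \<comment> \<open>By \<open>C = 1 + U * Y * Z * C ^ 2\<close> both sides agree after multiplication by the unit \<open>g1\<close>.\<close>
    have pole: "1 - U * Z * g2 * C = d1 * (1 - q)"
      using d1 C unfolding d1_def q_def by algebra
    have num: "?num = - 8 * U * Y * Z * (C * d1)"
      unfolding A B d1_def by (simp add: algebra_simps)
    have den: "?den = - 8 * U * Y * Z * (d * (1 - U * Z * g2 * C))"
      unfolding A B d_def by (simp add: algebra_simps)
    have "E * (d * (1 - U * Z * g2 * C)) = C * d1"
      unfolding pole using R d by algebra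
    then have "E * ?den = ?num"
      unfolding num den by algebra
    moreover have "?den \<noteq> 0"
    proof -
      have "d $ 0 = 1" "(1 - U * Z * g2 * C) $ 0 = 1"
        by (simp_all add: d_def vars)
      then have "d \<noteq> 0" "1 - U * Z * g2 * C \<noteq> 0"
        by (metis fps_zero_nth zero_neq_one)+
      then show ?thesis
        unfolding den using nz by (simp add: vars)
    qed
    ultimately show ?thesis
      by (metis nonzero_mult_div_cancel_right)
  qed
  with gf show ?thesis
    unfolding Let_def vars[symmetric] C_def[symmetric] A_def[symmetric] B_def[symmetric]
      g_def[symmetric] g1_def[symmetric] g2_def[symmetric] q_def[symmetric] E_def[symmetric]
    by blast
qed

end
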